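(* Let $k\ge3$ and let $W_a$ be the affine Weyl group of type $\widetilde D_k$ acting on $V=\mathbb{R}^k$, with fundamental alcove $\mathcal A=\{x\in\mathbb{R}^k:x_1>\cdots>x_{k-1}>|x_k|,\ x_1+x_2<1\}$. Let $X=(X^1,\dots,X^k)$ be a reflectable process in $\mathbb{R}^k$ (with respect to $W_a$) having independent components in orthogonal directions, let $x\in\mathcal A$, and let $\widetilde T$ be the first exit time of $X$ from $\mathcal A$. Then for every $t\ge0$ $$\mathbb{P}_x(\widetilde T>t)=\begin{cases}\mathrm{Pf}(\breve p_{ij})_{i,j\in[k]} & \text{if $k$ is even},\\[2pt] \displaystyle\sum_{l=1}^k(-1)^{l-1}\,\mathrm{Pf}(\breve p_{ij})_{i,j\in[k]\setminus\{l\}} & \text{if $k$ is odd},\end{cases}$$ where for $i<j$, $\breve p_{ij}=\mathbb{P}_x(\forall s\le t,\ 1>X^i_s-X^j_s>0)\cdot\mathbb{P}_x(\forall s\le t,\ 1>X^i_s+X^j_s>0)$ and $\breve p_{ji}=-\breve p_{ij}$.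
   Context: $[k]=\{1,\dots,k\}$. $W_a$ consists of the maps $x\mapsto w(x)+d$, with $w$ an evenly signed permutation of the coordinates of $\mathbb{R}^k$ (a signed permutation with an even number of sign changes) and $d\in L=\{d\in\mathbb{Z}^k:\sum_id_i\text{ is even}\}$. $X=(X_t)_{t\ge0}$ has law $\mathbb{P}_x$ when started at $x$; it is reflectable if it has the strong Markov property, almost surely continuous sample paths, and $W_a$-invariant law: $\mathbb{P}_x\circ(wX)^{-1}=\mathbb{P}_{wx}\circ X^{-1}$ for all $w\in W_a$, $x\in V$. "Independent components in orthogonal directions" means that under each $\mathbb{P}_x$ the projections of $X$ onto pairwise orthogonal subspaces are independent processes. $\mathrm{Pf}$ denotes the Pfaffian: $\mathrm{Pf}(a_{ij})=\sum_\pi(-1)^{c(\pi)}\prod_{\{i<j\}\in\pi}a_{ij}$, summed over partitions $\pi$ of the (ordered) index set into pairs, $c(\pi)$ being the number of crossings (pairs of blocks $\{i<j\},\{i'<j'\}$ with $i<i'<j<j'$). *)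

theory Defs
  imports "HOL-Probability.Probability" "HOL-Probability.Stopping_Time"
begin

section \<open>Coordinates of \<open>\<real>\<^sup>k\<close>\<close>

text \<open>
  \<open>\<real>\<^sup>k\<close> is \<open>real ^ 'k\<close> with \<open>k = CARD('k)\<close>; the linear order on \<open>'k\<close> identifies \<open>'k\<close> with
  \<open>{1..k}\<close>, so that \<open>coord x i\<close> is the \<open>i\<close>-th coordinate of \<open>x\<close> for \<open>i \<in> {1..k}\<close>.
\<close>

definition coord :: "real ^ 'k::{finite,linorder} \<Rightarrow> nat \<Rightarrow> real" where
  "coord x i = x $ (sorted_list_of_set (UNIV :: 'k set) ! (i - 1))"

section \<open>The affine Weyl group of type \<open>D\<close> and its alcove\<close>

definition even_signed_perms :: "(real ^ 'k::finite \<Rightarrow> real ^ 'k) set" where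
  "even_signed_perms =
    {w. \<exists>\<sigma> \<epsilon>. \<sigma> permutes UNIV \<and> (\<forall>i. \<epsilon> i \<in> {- 1, 1}) \<and> even (card {i. \<epsilon> i = - 1}) \<and>
       w = (\<lambda>x. \<chi> i. \<epsilon> i * x $ \<sigma> i)}"

definition even_lattice :: "(real ^ 'k::finite) set" where
  "even_lattice = {d. (\<forall>i. d $ i \<in> \<int>) \<and> (\<exists>m::int. (\<Sum>i\<in>UNIV. d $ i) = 2 * of_int m)}"

definition affine_weyl_D :: "(real ^ 'k::finite \<Rightarrow> real ^ 'k) set" where
  "affine_weyl_D = {\<lambda>x. w x + d | w d. w \<in> even_signed_perms \<and> d \<in> even_lattice}"

definition alcove_D :: "(real ^ 'k::{finite,linorder}) set" where
  "alcove_D = {x. (\<forall>i. 1 \<le> i \<and> i + 1 \<le> CARD('k) - 1 \<longrightarrow> coord x i > coord x (i + 1)) \<and>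
                  coord x (CARD('k) - 1) > \<bar>coord x CARD('k)\<bar> \<and>
                  coord x 1 + coord x 2 < 1}"

section \<open>Pfaffians\<close>

definition pair_partitions :: "'i set \<Rightarrow> 'i set set set" where
  "pair_partitions I = {\<pi>. partition_on I \<pi> \<and> (\<forall>B\<in>\<pi>. card B = 2)}"

definition crossings :: "'i::linorder set set \<Rightarrow> nat" where
  "crossings \<pi> =
    card {(B, B'). B \<in> \<pi> \<and> B' \<in> \<pi> \<and> Min B < Min B' \<and> Min B' < Max B \<and> Max B < Max B'}"

definition pfaffian :: "'i::linorder set \<Rightarrow> ('i \<Rightarrow> 'i \<Rightarrow> real) \<Rightarrow> real" where
  "pfaffian I a = (\<Sum>\<pi>\<in>pair_partitions I. (- 1) ^ crossings \<pi> * (\<Prod>B\<in>\<pi>. a (Min B) (Max B)))"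

section \<open>Reflectable processes\<close>

text \<open>
  A process is a family \<open>X :: real \<Rightarrow> 'w \<Rightarrow> real ^ 'k\<close>, of which only the times \<open>t \<ge> 0\<close> matter, on
  a measurable space \<open>M\<close>, together with probability measures \<open>P x\<close> on \<open>M\<close>. The measure
  carried by \<open>M\<close> itself is irrelevant.
\<close>

definition path_space :: "(real \<Rightarrow> real ^ 'k::finite) measure" where
  "path_space = Pi\<^sub>M {0..} (\<lambda>_. borel)"

definition trajectory :: "(real \<Rightarrow> 'w \<Rightarrow> real ^ 'k::finite) \<Rightarrow> 'w \<Rightarrow> real \<Rightarrow> real ^ 'k" where
  "trajectory Y \<omega> = (\<lambda>t\<in>{0..}. Y t \<omega>)"

definition law :: "'w measure \<Rightarrow> (real \<Rightarrow> 'w \<Rightarrow> real ^ 'k::finite) \<Rightarrow> (real \<Rightarrow> real ^ 'k) measure" where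
  "law N Y = distr N path_space (trajectory Y)"

text \<open>
  As paths are only almost surely continuous, events such as \<open>\<forall>s\<le>t. X s \<omega> \<in> A\<close> are in
  general measurable only for the completed measure.
\<close>

definition prob_of :: "'w measure \<Rightarrow> ('w \<Rightarrow> bool) \<Rightarrow> real" where
  "prob_of N E = measure (completion N) {\<omega>\<in>space N. E \<omega>}"

definition exit_time :: "(real \<Rightarrow> 'w \<Rightarrow> 'v) \<Rightarrow> 'v set \<Rightarrow> 'w \<Rightarrow> ennreal" where
  "exit_time X A \<omega> = Inf (ennreal ` {t. 0 \<le> t \<and> X t \<omega> \<notin> A})"

text \<open>
  The time set of the filtrations is \<open>[0,\<infinity>]\<close>, to allow for infinite stopping times.
\<close>

definition natural_filtration ::
    "'w measure \<Rightarrow> (real \<Rightarrow> 'w \<Rightarrow> real ^ 'k::finite) \<Rightarrow> ennreal \<Rightarrow> 'w measure" where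
  "natural_filtration M X t =
    sigma (space M) {X s -` B \<inter> space M | s B. 0 \<le> s \<and> ennreal s \<le> t \<and> B \<in> sets borel}"

text \<open>
  The right-continuous filtration \<open>F\<^sub>t\<^sub>+\<close>, the intersection of the \<open>F\<^sub>u\<close> for \<open>u > t\<close>;
  the disjunct \<open>u = \<infinity>\<close> only serves to make it \<open>F\<^sub>\<infinity>\<close> at \<open>t = \<infinity>\<close>.
\<close>

definition right_filtration ::
    "'w measure \<Rightarrow> (real \<Rightarrow> 'w \<Rightarrow> real ^ 'k::finite) \<Rightarrow> ennreal \<Rightarrow> 'w measure" where
  "right_filtration M X t =
    sigma (space M) (\<Inter>u\<in>{u. t < u \<or> u = \<infinity>}. sets (natural_filtration M X u))"

lemma space_natural_filtration [simp]: "space (natural_filtration M X t) = space M"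
  unfolding natural_filtration_def by (intro space_measure_of) auto

lemma sets_natural_filtration_mono:
  "t \<le> u \<Longrightarrow> sets (natural_filtration M X t) \<subseteq> sets (natural_filtration M X u)"
  unfolding natural_filtration_def
  by (subst (1 2) sets_measure_of) (auto intro!: sigma_sets_mono' dest: order_trans)

lemma right_filtration_sets_Pow:
  "(\<Inter>u\<in>{u. t < u \<or> u = \<infinity>}. sets (natural_filtration M X u)) \<subseteq> Pow (space M)"
  using sets.space_closed[of "natural_filtration M X \<infinity>"] by auto

lemma space_right_filtration [simp]: "space (right_filtration M X t) = space M"
  unfolding right_filtration_def by (intro space_measure_of right_filtration_sets_Pow)

lemma sets_right_filtration:
  "sets (right_filtration M X t) = (\<Inter>u\<in>{u. t < u \<or> u = \<infinity>}. sets (natural_filtration M X u))"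
proof -
  let ?S = "\<Inter>u\<in>{u. t < u \<or> u = \<infinity>}. sets (natural_filtration M X u)"
  have sub: "?S \<subseteq> Pow (space M)"
    by (rule right_filtration_sets_Pow)
  have "sigma_sets (space M) ?S \<subseteq> sets (natural_filtration M X u)" if "t < u \<or> u = \<infinity>" for u
    using sets.sigma_sets_subset[of ?S "natural_filtration M X u"] that by auto
  then have "sigma_sets (space M) ?S = ?S"
    by blast
  with sub show ?thesis
    unfolding right_filtration_def by simp
qed

lemma filtration_right_filtration: "filtration (space M) (right_filtration M X)"
proof
  show "sets (right_filtration M X t) \<subseteq> sets (right_filtration M X u)" if "t \<le> u" for t u
    unfolding sets_right_filtration using that by (intro INT_anti_mono) auto
qed simp

definition strong_markov ::
    "'w measure \<Rightarrow> (real ^ 'k::finite \<Rightarrow> 'w measure) \<Rightarrow> (real \<Rightarrow> 'w \<Rightarrow> real ^ 'k) \<Rightarrow> bool" where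
  "strong_markov M P X \<longleftrightarrow>
    (\<forall>x T A B. stopping_time (right_filtration M X) T \<and>
       A \<in> sets (filtration.pre_sigma (space M) (right_filtration M X) T) \<and>
       B \<in> sets path_space \<longrightarrow>
       emeasure (completion (P x))
         {\<omega>\<in>A. T \<omega> < \<infinity> \<and> trajectory (\<lambda>s. X (enn2real (T \<omega>) + s)) \<omega> \<in> B} =
       (\<integral>\<^sup>+\<omega>\<in>{\<omega>\<in>A. T \<omega> < \<infinity>}. emeasure (law (P (X (enn2real (T \<omega>)) \<omega>)) X) B \<partial>completion (P x)))"

definition reflectable ::
    "(real ^ 'k \<Rightarrow> real ^ 'k) set \<Rightarrow> 'w measure \<Rightarrow> (real ^ 'k::finite \<Rightarrow> 'w measure) \<Rightarrow>
      (real \<Rightarrow> 'w \<Rightarrow> real ^ 'k) \<Rightarrow> bool" where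
  "reflectable W M P X \<longleftrightarrow>
    (\<forall>x. prob_space (P x) \<and> sets (P x) = sets M) \<and>
    (\<forall>t\<ge>0. X t \<in> borel_measurable M) \<and>
    (\<lambda>x. law (P x) X) \<in> borel \<rightarrow>\<^sub>M prob_algebra path_space \<and>
    (\<forall>x. AE \<omega> in P x. X 0 \<omega> = x) \<and>
    strong_markov M P X \<and>
    (\<forall>x. AE \<omega> in P x. continuous_on {0..} (\<lambda>t. X t \<omega>)) \<and>
    (\<forall>w\<in>W. \<forall>x. law (P x) (\<lambda>t \<omega>. w (X t \<omega>)) = law (P (w x)) X)"

definition orthogonal_projection :: "(real ^ 'k::finite) set \<Rightarrow> real ^ 'k \<Rightarrow> real ^ 'k" where
  "orthogonal_projection S v = (THE u. u \<in> S \<and> (\<forall>z\<in>S. orthogonal (v - u) z))"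

definition indep_orthogonal_components ::
    "(real ^ 'k::finite \<Rightarrow> 'w measure) \<Rightarrow> (real \<Rightarrow> 'w \<Rightarrow> real ^ 'k) \<Rightarrow> bool" where
  "indep_orthogonal_components P X \<longleftrightarrow>
    (\<forall>\<S>. (\<forall>S\<in>\<S>. subspace S) \<and> pairwise (\<lambda>S S'. \<forall>u\<in>S. \<forall>v\<in>S'. orthogonal u v) \<S> \<longrightarrow>
      (\<forall>x. prob_space.indep_vars (P x) (\<lambda>_. path_space)
             (\<lambda>S. trajectory (\<lambda>t \<omega>. orthogonal_projection S (X t \<omega>))) \<S>))"

definition p_breve ::
    "'w measure \<Rightarrow> (real \<Rightarrow> 'w \<Rightarrow> real ^ 'k::{finite,linorder}) \<Rightarrow> real \<Rightarrow> nat \<Rightarrow> nat \<Rightarrow> real" where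
  "p_breve N X t i j =
    (let p = (\<lambda>i j.
       prob_of N (\<lambda>\<omega>. \<forall>s\<in>{0..t}. 1 > coord (X s \<omega>) i - coord (X s \<omega>) j \<and>
                                  coord (X s \<omega>) i - coord (X s \<omega>) j > 0) *
       prob_of N (\<lambda>\<omega>. \<forall>s\<in>{0..t}. 1 > coord (X s \<omega>) i + coord (X s \<omega>) j \<and>
                                  coord (X s \<omega>) i + coord (X s \<omega>) j > 0))
     in if i < j then p i j else if j < i then - p j i else 0)"

end

(*
The proof is a reflection principle. For a pair partition pi let F(pi) be the event that up to time
t the path satisfies 0 < x_i - x_j < 1 and 0 < x_i + x_j < 1 for all blocks {i < j} of pi. The
vectors e_i - e_j, e_i + e_j are orthogonal, so P(F(pi)) is the product of the entries of the
Pfaffian, which is therefore the signed sum of the P(F(pi)). If the path does not leave the alcove,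
all F(pi) occur, and the signs of all pair partitions add up to 1. If it leaves through a wall,
let (a, a+1) be the pair of indices of the coordinates involved. F(pi) fails if {a, a+1} is a block
of pi; otherwise, reflecting the path after the exit exchanges F(pi) and F(pi'), where pi' arises
from pi by swapping a and a+1, and has the opposite sign. These contributions cancel.
For odd k, the alternating sum of Pfaffians is the Pfaffian over k+1 indices with entries 1 in the
last column, so pi becomes a pair partition of {1..k+1} and blocks containing k+1 impose no
condition.
*)

theory Submission
  imports Defs
begin

section \<open>Signs of pair partitions\<close>

text \<open>A reflection acts as a mere swap of indices because of a symmetry of the block
  conditions: the pair of strips \<open>0 < x_i - x_j < 1\<close> and
  \<open>0 < x_i + x_j < 1\<close> is preserved, as a pair, by \<open>x_j := - x_j\<close> and by
  \<open>x_i := 1 - x_i\<close>. The reflection in \<open>x_(k-1) + x_k = 0\<close> swaps and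
  negates, but in every other block that imposes a condition \<open>k - 1\<close> and
  \<open>k\<close> are larger indices. The reflection in \<open>x_1 + x_2 = 1\<close> swaps and
  applies \<open>1 - x\<close>, but in every other block 1 and 2 are smaller indices. The added
  index \<open>k + 1\<close> is never swapped, so both parities share one cancellation argument. The
  total sign 1 comes from the same involution, applied to combinatorial weights instead of
  probabilities. The analytic obstacle is that paths are continuous only almost surely, while the
  strong Markov property refers to an uncompleted filtration; hence the encoding of events by
  rational times.\<close>

lemma pair_partitions_iff:
  "\<pi> \<in> pair_partitions I \<longleftrightarrow> partition_on I \<pi> \<and> (\<forall>B\<in>\<pi>. card B = 2)"
  by (simp add: pair_partitions_def)

lemma finite_pair_partitions: "finite I \<Longrightarrow> finite (pair_partitions I)"
  using finitely_many_partition_on[of I] by (rule finite_subset[rotated]) (auto simp: pair_partitions_def)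

lemma pair_block:
  assumes "card B = 2"
  obtains u v where "B = {u, v :: 'i::linorder}" "u < v" "Min B = u" "Max B = v"
proof -
  from assms obtain u v where "B = {u, v}" "u \<noteq> v" by (auto simp: card_2_iff)
  then show ?thesis
    using that[of u v] that[of v u] by (cases u v rule: linorder_cases) auto
qed

text \<open>Writing the sign of a partition as a product over ordered pairs of blocks lets the
  effect of a relabelling be checked pair by pair.\<close>

definition crossing_sign :: "'i::linorder set \<Rightarrow> 'i set \<Rightarrow> real" where
  "crossing_sign B B' =
    (if Min B < Min B' \<and> Min B' < Max B \<and> Max B < Max B' then - 1 else 1)"

lemma sign_crossings:
  assumes "finite \<pi>"
  shows "(- 1 :: real) ^ crossings \<pi> = (\<Prod>(B, B')\<in>\<pi> \<times> \<pi>. crossing_sign B B')"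
proof -
  let ?C = "{(B, B'). B \<in> \<pi> \<and> B' \<in> \<pi> \<and> Min B < Min B' \<and> Min B' < Max B \<and> Max B < Max B'}"
  have "(\<Prod>(B, B')\<in>\<pi> \<times> \<pi>. crossing_sign B B') = (\<Prod>p\<in>\<pi> \<times> \<pi>. if p \<in> ?C then - 1 else 1)"
    by (rule prod.cong) (auto simp only: crossing_sign_def split: if_splits)
  also have "\<dots> = (\<Prod>p\<in>\<pi> \<times> \<pi> \<inter> ?C. - 1)"
    using assms by (subst prod.inter_restrict) auto
  also have "\<pi> \<times> \<pi> \<inter> ?C = ?C" by auto
  finally show ?thesis by (simp add: crossings_def)
qed

section \<open>Sign reversal under exchange of two adjacent indices\<close>

abbreviation adj_swap :: "nat \<Rightarrow> nat \<Rightarrow> nat" where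
  "adj_swap i \<equiv> Transposition.transpose i (Suc i)"

definition swap_partition :: "nat \<Rightarrow> nat set set \<Rightarrow> nat set set" where
  "swap_partition i \<pi> = image (adj_swap i) ` \<pi>"

lemma swap_partition_twice [simp]: "swap_partition i (swap_partition i \<pi>) = \<pi>"
  by (simp add: swap_partition_def image_image)

lemma mem_swap_partition:
  "B \<in> swap_partition i \<pi> \<longleftrightarrow> adj_swap i ` B \<in> \<pi>"
proof
  assume "adj_swap i ` B \<in> \<pi>"
  then have "adj_swap i ` adj_swap i ` B \<in> swap_partition i \<pi>"
    unfolding swap_partition_def by (rule imageI)
  then show "B \<in> swap_partition i \<pi>" by (simp add: image_image)
qed (auto simp: swap_partition_def image_image)

lemma swap_partition_pair_partitions:
  assumes "\<pi> \<in> pair_partitions I" "i \<in> I" "Suc i \<in> I"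
  shows "swap_partition i \<pi> \<in> pair_partitions I"
proof -
  let ?\<sigma> = "adj_swap i"
  have \<sigma>: "inj_on ?\<sigma> S" for S by (auto intro: inj_on_subset[OF inj_transpose])
  have "?\<sigma> ` I = I"
    using assms by (auto simp: Transposition.transpose_def image_iff Bex_def split: if_splits)
  moreover have "partition_on (?\<sigma> ` I) (image ?\<sigma> ` \<pi> - {{}})"
    using assms \<sigma> by (intro partition_on_transform) (auto simp: pair_partitions_iff disjnt_def inj_on_def)
  moreover have "image ?\<sigma> ` \<pi> - {{}} = swap_partition i \<pi>"
    using assms by (auto simp: swap_partition_def pair_partitions_iff partition_on_def)
  ultimately show ?thesis
    using assms \<sigma> by (auto simp: pair_partitions_iff swap_partition_def card_image)
qed

text \<open>No number lies strictly between \<open>i\<close> and \<open>Suc i\<close>, so exchanging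
  them affects no comparison except the one between themselves.\<close>

lemma transpose_less_iff:
  assumes "u \<noteq> v" "{u, v} \<noteq> {i, Suc i}"
  shows "adj_swap i u < adj_swap i v \<longleftrightarrow> u < v"
  using assms by (auto simp: Transposition.transpose_def)

lemma Min_Max_transpose:
  assumes "card B = 2" "B \<noteq> {i, Suc i}"
  shows "Min (adj_swap i ` B) = adj_swap i (Min B)"
    and "Max (adj_swap i ` B) = adj_swap i (Max B)"
proof -
  obtain u v where B: "B = {u, v}" "u < v" "Min B = u" "Max B = v"
    using assms(1) by (rule pair_block)
  then have "adj_swap i u < adj_swap i v"
    using assms(2) by (subst transpose_less_iff) auto
  with B show "Min (adj_swap i ` B) = adj_swap i (Min B)"
    "Max (adj_swap i ` B) = adj_swap i (Max B)" by auto
qed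

text \<open>Only the block of \<open>i\<close> and the block of \<open>Suc i\<close> can change
  their mutual position. Since they are different blocks, the swap toggles whether these two
  cross.\<close>

lemma sign_swap_partition:
  assumes \<pi>: "\<pi> \<in> pair_partitions I" "finite I" "i \<in> I" "Suc i \<in> I" and "{i, Suc i} \<notin> \<pi>"
  shows "(- 1 :: real) ^ crossings (swap_partition i \<pi>) = - ((- 1) ^ crossings \<pi>)"
proof -
  let ?\<sigma> = "adj_swap i"
  have part: "partition_on I \<pi>" and card2: "\<And>B. B \<in> \<pi> \<Longrightarrow> card B = 2"
    using \<pi> by (auto simp: pair_partitions_iff)
  have disj: "B = B'" if "B \<in> \<pi>" "B' \<in> \<pi>" "u \<in> B" "u \<in> B'" for B B' u
    using part that by (auto simp: partition_on_def disjoint_def)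
  have fin: "finite \<pi>" using part \<pi>(2) by (rule finite_elements[rotated])
  obtain Bi Bs where Bi: "Bi \<in> \<pi>" "i \<in> Bi" and Bs: "Bs \<in> \<pi>" "Suc i \<in> Bs"
    using part \<pi>(3,4) by (auto simp: partition_on_def)
  obtain a where a: "Bi = {i, a}" "a \<noteq> i" using card2[OF Bi(1)] Bi(2) by (auto simp: card_2_iff)
  obtain b where b: "Bs = {Suc i, b}" "b \<noteq> Suc i" using card2[OF Bs(1)] Bs(2) by (auto simp: card_2_iff)
  have ne: "Bi \<noteq> Bs" using a b Bi Bs \<open>{i, Suc i} \<notin> \<pi>\<close> by (auto simp: doubleton_eq_iff)
  have neq: "a \<noteq> Suc i" "b \<noteq> i" "a \<noteq> b"
    using a b ne Bi Bs disj[of Bi Bs] by auto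
  let ?s = "\<lambda>(B, B'). crossing_sign B B'" and ?s' = "\<lambda>(B, B'). crossing_sign (?\<sigma> ` B) (?\<sigma> ` B')"
  \<comment> \<open>For any other pair of blocks, no comparison between their elements is one
    between \<open>i\<close> and \<open>Suc i\<close>. The diagonal pairs \<open>B = B'\<close> have
    sign 1 before and after.\<close>
  have same: "?s' p = ?s p" if p\<pi>: "p \<in> \<pi> \<times> \<pi>" and p_neq: "p \<noteq> (Bi, Bs)" "p \<noteq> (Bs, Bi)" for p
  proof -
    obtain B B' where p: "p = (B, B')" "B \<in> \<pi>" "B' \<in> \<pi>" using p\<pi> by (cases p) auto
    have B: "B \<noteq> {i, Suc i}" "B' \<noteq> {i, Suc i}" using p \<open>{i, Suc i} \<notin> \<pi>\<close> by auto
    have mem: "Min B \<in> B" "Max B \<in> B" "Min B' \<in> B'" "Max B' \<in> B'"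
      using pair_block[OF card2[OF p(2)]] pair_block[OF card2[OF p(3)]]
      by (metis insertCI)+
    have "\<not> (i \<in> B \<and> Suc i \<in> B')" "\<not> (i \<in> B' \<and> Suc i \<in> B)"
      using disj Bi Bs p p_neq by metis+
    then have "{u, v} \<noteq> {i, Suc i}" if "u \<in> B" "v \<in> B'" for u v
      using that by (auto simp: doubleton_eq_iff)
    then have "?\<sigma> u < ?\<sigma> v \<longleftrightarrow> u < v" "?\<sigma> v < ?\<sigma> u \<longleftrightarrow> v < u" if "B \<noteq> B'" "u \<in> B" "v \<in> B'" for u v
      using that disj[OF p(2,3)] by (metis transpose_less_iff insert_commute)+
    then show ?thesis
      using mem B card2 p by (cases "B = B'") (auto simp: crossing_sign_def Min_Max_transpose)
  qed
  \<comment> \<open>The swap amounts to exchanging the partners \<open>a\<close> and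
    \<open>b\<close>. In each order of \<open>a\<close>, \<open>b\<close> and the adjacent numbers
    \<open>i\<close>, \<open>Suc i\<close>, exactly one of the two configurations is
    crossing.\<close>
  have flip: "?s' (Bi, Bs) * ?s' (Bs, Bi) = - (?s (Bi, Bs) * ?s (Bs, Bi))"
  proof -
    have "?\<sigma> ` Bi = {Suc i, a}" "?\<sigma> ` Bs = {i, b}"
      using a b neq by (auto simp: Transposition.transpose_def)
    moreover have "a < i \<or> Suc i < a" "b < i \<or> Suc i < b" "a < b \<or> b < a"
      using a b neq by auto
    ultimately show ?thesis
      using a b neq by (auto simp: crossing_sign_def min_def max_def)
  qed
  let ?R = "\<pi> \<times> \<pi> - {(Bi, Bs)} - {(Bs, Bi)}"
  have split: "prod g (\<pi> \<times> \<pi>) = (g (Bi, Bs) * g (Bs, Bi)) * prod g ?R" for g :: "_ \<Rightarrow> real"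
    using Bi Bs ne fin
    by (subst prod.remove[of _ "(Bi, Bs)"], simp, simp, subst prod.remove[of _ "(Bs, Bi)"]) auto
  have inj: "inj_on (image ?\<sigma>) \<pi>" by (auto intro!: inj_onI simp: inj_image_eq_iff)
  have "(- 1 :: real) ^ crossings (swap_partition i \<pi>)
      = (\<Prod>(B, B')\<in>map_prod (image ?\<sigma>) (image ?\<sigma>) ` (\<pi> \<times> \<pi>). crossing_sign B B')"
    using fin by (subst sign_crossings) (auto simp: swap_partition_def intro!: prod.cong)
  also have "\<dots> = (\<Prod>p\<in>\<pi> \<times> \<pi>. ?s' p)"
    using inj by (subst prod.reindex) (auto intro!: map_prod_inj_on simp: case_prod_beta)
  also have "\<dots> = - (\<Prod>p\<in>\<pi> \<times> \<pi>. ?s p)"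
  proof -
    have "prod ?s' ?R = prod ?s ?R" by (rule prod.cong[OF refl]) (auto intro!: same[simplified case_prod_beta, simplified] simp: case_prod_beta)
    then show ?thesis unfolding split flip by simp
  qed
  also have "(\<Prod>p\<in>\<pi> \<times> \<pi>. ?s p) = (- 1) ^ crossings \<pi>"
    using fin by (simp add: sign_crossings case_prod_beta)
  finally show ?thesis .
qed

text \<open>The swap is a sign-reversing involution on the partitions without the block
  \<open>{i, Suc i}\<close>. Partitions with that block are its fixed points, so their weight has to
  vanish. The weight \<open>f\<close> is an indicator in the count of signs and a probability in the
  reflection argument.\<close>

lemma sum_sign_swap_cancel:
  fixes f :: "nat set set \<Rightarrow> real"
  assumes "finite I" "i \<in> I" "Suc i \<in> I"
    and zero: "\<And>\<pi>. \<pi> \<in> pair_partitions I \<Longrightarrow> {i, Suc i} \<in> \<pi> \<Longrightarrow> f \<pi> = 0"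
    and swap: "\<And>\<pi>. \<pi> \<in> pair_partitions I \<Longrightarrow> {i, Suc i} \<notin> \<pi> \<Longrightarrow> f (swap_partition i \<pi>) = f \<pi>"
  shows "(\<Sum>\<pi>\<in>pair_partitions I. (- 1) ^ crossings \<pi> * f \<pi>) = 0"
proof -
  let ?Q = "{\<pi> \<in> pair_partitions I. {i, Suc i} \<notin> \<pi>}"
  let ?g = "\<lambda>\<pi>. (- 1) ^ crossings \<pi> * f \<pi>"
  have mem: "swap_partition i \<pi> \<in> ?Q" if "\<pi> \<in> ?Q" for \<pi>
    using that assms(2,3) by (auto simp: swap_partition_pair_partitions mem_swap_partition insert_commute)
  have "sum ?g (pair_partitions I) = sum ?g ?Q"
    using zero by (intro sum.mono_neutral_right) (auto simp: finite_pair_partitions assms(1))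
  moreover have "sum ?g ?Q = sum (\<lambda>\<pi>. ?g (swap_partition i \<pi>)) ?Q"
  proof (rule sum.reindex_bij_betw[symmetric])
    show "bij_betw (swap_partition i) ?Q ?Q"
      by (rule bij_betwI[where g = "swap_partition i"]) (use mem in blast, use mem in blast, rule swap_partition_twice, rule swap_partition_twice)
  qed
  moreover have "sum (\<lambda>\<pi>. ?g (swap_partition i \<pi>)) ?Q = - sum ?g ?Q"
    unfolding sum_negf[symmetric]
  proof (rule sum.cong[OF refl])
    fix \<pi> assume "\<pi> \<in> ?Q"
    then have *: "\<pi> \<in> pair_partitions I" "{i, Suc i} \<notin> \<pi>" by auto
    show "?g (swap_partition i \<pi>) = - ?g \<pi>"
      unfolding sign_swap_partition[OF *(1) assms(1-3) *(2)] swap[OF *] by simp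
  qed
  ultimately show ?thesis by linarith
qed

lemma sum_sign_pair_partitions: "(\<Sum>\<pi>\<in>pair_partitions {1..2 * m :: nat}. (- 1 :: real) ^ crossings \<pi>) = 1"
proof -
  let ?I = "{1..2 * m} :: nat set"
  \<comment> \<open>Swapping \<open>2j + 1\<close> and \<open>2j + 2\<close> cancels all partitions that contain the first \<open>j\<close> of the
    blocks \<open>{1, 2}, {3, 4}, \<dots>\<close> but not the next one.\<close>
  define S :: "nat \<Rightarrow> real" where "S j = (\<Sum>\<pi>\<in>pair_partitions ?I.
      (- 1) ^ crossings \<pi> * of_bool (\<forall>l<j. {2 * l + 1, 2 * l + 2} \<in> \<pi>))" for j
  have step: "S j = S (Suc j)" if "j < m" for j
  proof -
    let ?f = "\<lambda>\<pi>. of_bool ((\<forall>l<j. {2 * l + 1, 2 * l + 2} \<in> \<pi>) \<and> {2 * j + 1, 2 * j + 2} \<notin> \<pi>) :: real"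
    have "S j - S (Suc j) = (\<Sum>\<pi>\<in>pair_partitions ?I. (- 1) ^ crossings \<pi> * ?f \<pi>)"
      unfolding S_def sum_subtractf[symmetric]
      by (rule sum.cong) (auto simp: less_Suc_eq)
    also have "\<dots> = 0"
    proof (rule sum_sign_swap_cancel[where i = "2 * j + 1"])
      fix \<pi>
      \<comment> \<open>Blocks before the \<open>j\<close>-th are fixed pointwise and the
        \<open>j\<close>-th is fixed as a set, so the indicator \<open>?f\<close> does not see the
        swap.\<close>
      have "adj_swap (Suc (2 * j)) ` {Suc (2 * l), Suc (Suc (2 * l))} = {Suc (2 * l), Suc (Suc (2 * l))}"
        if "l \<le> j" for l using that by (cases "l = j") (auto simp: Transposition.transpose_def)
      then show "?f (swap_partition (2 * j + 1) \<pi>) = ?f \<pi>"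
        by (simp add: mem_swap_partition del: image_insert)
    qed (use that in auto)
    finally show ?thesis by simp
  qed
  \<comment> \<open>For \<open>j = m\<close> all prescribed blocks together already cover
    \<open>{1..2 * m}\<close>, so \<open>S m\<close> has this partition as its only term.\<close>
  let ?\<pi> = "(\<lambda>l. {2 * l + 1, 2 * l + 2}) ` {..<m}"
  have "S j = S 0" if "j \<le> m" for j
    using that by (induction j) (auto simp: step)
  then have "(\<Sum>\<pi>\<in>pair_partitions ?I. (- 1 :: real) ^ crossings \<pi>) = S m"
    by (simp add: S_def)
  also have "S m = (\<Sum>\<pi>\<in>{?\<pi>}. (- 1) ^ crossings \<pi>)"
  proof -
    have cover: "\<exists>l<m. i \<in> {2 * l + 1, 2 * l + 2}" if "i \<in> ?I" for i
    proof (intro exI conjI)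
      show "(i - 1) div 2 < m" using that by auto
      show "i \<in> {2 * ((i - 1) div 2) + 1, 2 * ((i - 1) div 2) + 2}"
        using that by (cases "even i") (auto elim!: evenE oddE)
    qed
    have "?\<pi> \<in> pair_partitions ?I"
    proof -
      have 1: "\<Union>?\<pi> = ?I"
      proof
        show "?I \<subseteq> \<Union>?\<pi>" using cover by blast
      qed auto
      have "disjoint ?\<pi>"
      proof (rule disjointI, clarify)
        fix l l' assume "{2 * l + 1, 2 * l + 2} \<noteq> {2 * l' + 1, 2 * l' + 2 :: nat}"
        then have "l \<noteq> l'" by auto
        moreover have "2 * l + 1 \<noteq> 2 * l' + 2" "2 * l + 2 \<noteq> 2 * l' + 1" by presburger+
        ultimately show "{2 * l + 1, 2 * l + 2} \<inter> {2 * l' + 1, 2 * l' + 2} = {}" by auto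
      qed
      with 1 show ?thesis by (auto simp: pair_partitions_iff partition_on_def)
    qed
    moreover have "\<pi> = ?\<pi>" if \<pi>: "\<pi> \<in> pair_partitions ?I" "\<forall>l<m. {2 * l + 1, 2 * l + 2} \<in> \<pi>" for \<pi>
    proof -
      have "B \<in> ?\<pi>" if "B \<in> \<pi>" for B
      proof -
        from \<pi>(1) that obtain i where i: "i \<in> B" "i \<in> ?I"
          by (auto simp: pair_partitions_iff partition_on_def) (metis UnionI atLeastAtMost_iff ex_in_conv)
        then obtain l where l: "l < m" "i \<in> {2 * l + 1, 2 * l + 2}" using cover by blast
        moreover have "{2 * l + 1, 2 * l + 2} \<in> \<pi>" using \<pi> l by blast
        moreover have "disjoint \<pi>" using \<pi>(1) by (simp add: pair_partitions_iff partition_on_def)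
        ultimately have "B = {2 * l + 1, 2 * l + 2}"
          using disjointD[of \<pi> B "{2 * l + 1, 2 * l + 2}"] that i by (metis disjoint_iff)
        then show ?thesis using l by blast
      qed
      with \<pi> show ?thesis by auto
    qed
    moreover have "\<forall>l<m. {2 * l + 1, 2 * l + 2} \<in> ?\<pi>" by blast
    ultimately have P0: "?\<pi> \<in> pair_partitions ?I" and *: "\<And>\<pi>. \<pi> \<in> pair_partitions ?I \<Longrightarrow> (\<forall>l<m. {2 * l + 1, 2 * l + 2} \<in> \<pi>) \<longleftrightarrow> \<pi> = ?\<pi>"
      by blast+
    have iff: "(\<forall>l<m. {2 * l + 1, 2 * l + 2} \<in> \<pi>) \<longleftrightarrow> \<pi> = ?\<pi>" if "\<pi> \<in> pair_partitions ?I" for \<pi>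
      using *[OF that] .
    have "S m = (\<Sum>\<pi>\<in>pair_partitions ?I. if \<pi> = ?\<pi> then (- 1) ^ crossings \<pi> else 0)"
      unfolding S_def by (rule sum.cong[OF refl], simp only: iff) (simp add: of_bool_def)
    also have "\<dots> = (\<Sum>\<pi>\<in>{?\<pi>}. (- 1) ^ crossings \<pi>)"
      using P0 by (simp only: sum.delta finite_pair_partitions finite_atLeastAtMost if_True) simp
    finally show ?thesis .
  qed
  also have "\<dots> = 1"
  proof -
    \<comment> \<open>A block consists of two consecutive numbers, so no minimum of another block
      lies strictly inside it.\<close>
    have *: "Min B' = Min B \<or> Min B' \<ge> Max B \<or> Min B' < Min B" if "B \<in> ?\<pi>" "B' \<in> ?\<pi>" for B B'
      using that by auto
    have "\<not> (B \<in> ?\<pi> \<and> B' \<in> ?\<pi> \<and> Min B < Min B' \<and> Min B' < Max B \<and> Max B < Max B')" for B B'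
      using *[of B B'] by linarith
    then have "{(B, B'). B \<in> ?\<pi> \<and> B' \<in> ?\<pi> \<and> Min B < Min B' \<and> Min B' < Max B \<and> Max B < Max B'} = {}"
      by (simp only: case_prod_conv simp_thms Collect_empty_eq split_paired_All)
    then have "crossings ?\<pi> = 0" unfolding crossings_def by (simp only: card.empty)
    then show ?thesis by simp
  qed
  finally show ?thesis .
qed

section \<open>Expansion of a Pfaffian along its last column\<close>

lemma crossings_insert_top:
  assumes \<pi>: "\<pi> \<in> pair_partitions ({1..k} - {l})" and l: "l \<in> {1..k}"
  shows "(- 1 :: real) ^ crossings (insert {l, Suc k} \<pi>) = (- 1) ^ (l - 1) * (- 1) ^ crossings \<pi>"
proof -
  let ?B = "{l, Suc k}"
  have part: "partition_on ({1..k} - {l}) \<pi>" and card2: "\<And>B. B \<in> \<pi> \<Longrightarrow> card B = 2"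
    using \<pi> by (auto simp: pair_partitions_iff)
  have fin: "finite \<pi>" using part by (rule finite_elements[rotated]) simp
  have sub: "B \<subseteq> {1..k} - {l}" if "B \<in> \<pi>" for B using part that by (auto simp: partition_on_def)
  have notin: "?B \<notin> \<pi>" using sub by auto
  have Bmm: "Min ?B = l" "Max ?B = Suc k" using l by auto
  \<comment> \<open>No block ends after \<open>Suc k\<close>, so the new block can only be the
    second member of a crossing.\<close>
  have s1: "crossing_sign ?B B = 1" if "B \<in> insert ?B \<pi>" for B
  proof (cases "B = ?B")
    case False
    with that have "Max B \<in> B" using card2[of B] by (intro Max_in) (auto simp: card_2_iff)
    then have "Max B \<le> k" using sub[of B] False that by auto
    then show ?thesis using l by (auto simp: crossing_sign_def)
  qed (simp add: crossing_sign_def)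
  have s2: "crossing_sign B ?B = (- 1) ^ card (B \<inter> {..<l})" if B\<pi>: "B \<in> \<pi>" for B
  proof -
    obtain u v where B: "B = {u, v}" "u < v" "Min B = u" "Max B = v"
      using pair_block[OF card2[OF B\<pi>]] by metis
    have "u \<noteq> l" "v \<noteq> l" "v \<le> k" using sub[OF B\<pi>] B by auto
    then show ?thesis
      using B l Bmm by (auto simp: crossing_sign_def Int_insert_left simp del: Min_insert Max_insert)
  qed
  \<comment> \<open>The blocks that cross \<open>{l, k + 1}\<close> are those with exactly one element below \<open>l\<close>.\<close>
  have "(- 1 :: real) ^ (l - 1) = (- 1) ^ card {1..<l}" by simp
  also have "{1..<l} = (\<Union>B\<in>\<pi>. B \<inter> {..<l})"
    using part l by (auto simp: partition_on_def)
  also have "card \<dots> = (\<Sum>B\<in>\<pi>. card (B \<inter> {..<l}))"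
    using fin part by (intro card_UN_disjoint) (auto simp: partition_on_def disjoint_def)
  also have "(- 1 :: real) ^ \<dots> = (\<Prod>B\<in>\<pi>. crossing_sign B ?B)"
    by (simp add: power_sum s2)
  finally have sign: "(\<Prod>B\<in>\<pi>. crossing_sign B ?B) = (- 1) ^ (l - 1)" ..
  have "(- 1 :: real) ^ crossings (insert ?B \<pi>)
      = (\<Prod>B\<in>insert ?B \<pi>. \<Prod>B'\<in>insert ?B \<pi>. crossing_sign B B')"
    using fin by (simp add: sign_crossings prod.cartesian_product)
  also have "\<dots> = (\<Prod>B\<in>\<pi>. \<Prod>B'\<in>insert ?B \<pi>. crossing_sign B B')"
    using fin notin s1 by (subst prod.insert) auto
  also have "\<dots> = (\<Prod>B\<in>\<pi>. crossing_sign B ?B) * (\<Prod>B\<in>\<pi>. \<Prod>B'\<in>\<pi>. crossing_sign B B')"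
    using fin notin by (simp add: prod.distrib)
  also have "\<dots> = (- 1) ^ (l - 1) * (- 1) ^ crossings \<pi>"
    using fin by (simp add: sign sign_crossings prod.cartesian_product)
  finally show ?thesis .
qed

text \<open>Each pair partition of \<open>{1..Suc k}\<close> has a unique block
  \<open>{l, Suc k}\<close>, and removing it leaves a pair partition of \<open>{1..k} - {l}\<close>.
  Entries are evaluated at \<open>(Min B, Max B)\<close>, so the value 1 for \<open>j > k\<close> is
  precisely the last column.\<close>

lemma sum_pfaffian_delete:
  "(\<Sum>l = 1..k. (- 1) ^ (l - 1) * pfaffian ({1..k} - {l}) a) =
     pfaffian {1..Suc k} (\<lambda>i j. if j \<le> k then a i j else 1)" (is "?L = pfaffian _ ?a")
proof -
  let ?S = "SIGMA l:{1..k}. pair_partitions ({1..k} - {l})"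
  let ?ins = "\<lambda>(l, \<pi>). insert {l, Suc k} \<pi>"
  have notin: "{l, Suc k} \<notin> \<pi>" if "\<pi> \<in> pair_partitions ({1..k} - {l'})" for l l' \<pi>
  proof
    assume "{l, Suc k} \<in> \<pi>"
    then have "Suc k \<in> \<Union>\<pi>" by blast
    with that show False by (simp add: pair_partitions_iff partition_on_def)
  qed
  have "bij_betw ?ins ?S (pair_partitions {1..Suc k})"
    unfolding bij_betw_def
  proof
    show "inj_on ?ins ?S"
    proof (rule inj_onI, clarify)
      fix l \<pi> l' \<pi>' assume *: "\<pi> \<in> pair_partitions ({1..k} - {l})" "\<pi>' \<in> pair_partitions ({1..k} - {l'})"
        "insert {l, Suc k} \<pi> = insert {l', Suc k} \<pi>'" "l \<in> {1..k}" "l' \<in> {1..k}"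
      have "{l, Suc k} \<in> insert {l', Suc k} \<pi>'" unfolding *(3)[symmetric] by simp
      then have "{l, Suc k} = {l', Suc k}" using notin[OF *(2)] by simp
      then have "l = l'" by (metis doubleton_eq_iff)
      moreover from this have "\<pi> = \<pi>'" using *(3) notin[OF *(1)] notin[OF *(2)] by (simp add: insert_ident)
      ultimately show "l = l' \<and> \<pi> = \<pi>'" by simp
    qed
    show "?ins ` ?S = pair_partitions {1..Suc k}"
    proof (intro equalityI subsetI)
      fix \<rho> assume "\<rho> \<in> ?ins ` ?S"
      then obtain l \<pi> where *: "\<rho> = insert {l, Suc k} \<pi>" "l \<in> {1..k}" "\<pi> \<in> pair_partitions ({1..k} - {l})"
        by auto
      then have part: "partition_on ({1..k} - {l}) \<pi>" by (simp add: pair_partitions_iff)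
      have I: "{1..Suc k} - {l, Suc k} = {1..k} - {l}" "{l, Suc k} \<subseteq> {1..Suc k}" using *(2) by auto
      have "disjnt {l, Suc k} (\<Union>\<pi>)" using part by (auto simp: partition_on_def disjnt_def)
      then have "partition_on {1..Suc k} (insert {l, Suc k} \<pi>)"
        using part I by (simp add: partition_on_insert)
      then show "\<rho> \<in> pair_partitions {1..Suc k}" using * by (auto simp: pair_partitions_iff)
    next
      fix \<rho> assume \<rho>: "\<rho> \<in> pair_partitions {1..Suc k}"
      then have \<rho>': "\<Union>\<rho> = {1..Suc k}" "\<And>B. B \<in> \<rho> \<Longrightarrow> card B = 2"
        by (auto simp: pair_partitions_iff partition_on_def)
      have "Suc k \<in> \<Union>\<rho>" unfolding \<rho>' by simp
      then obtain B where B: "B \<in> \<rho>" "Suc k \<in> B" by blast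
      from \<rho>'(2)[OF B(1)] obtain u v where "B = {u, v}" "u \<noteq> v" by (auto simp: card_2_iff)
      with B(2) obtain l where l: "B = {l, Suc k}" "l \<noteq> Suc k" by (metis insert_commute insertE singletonD)
      have "l \<in> \<Union>\<rho>" using B l by blast
      then have "l \<in> {1..k}" unfolding \<rho>' using l by auto
      have "partition_on ({1..k} - {l}) (\<rho> - {B})"
      proof -
        have "{1..k} - {l} = {1..Suc k} - B" using l by auto
        moreover have "partition_on ({1..Suc k} - B) (\<rho> - {B})"
        proof -
          have "disjnt B (\<Union>(\<rho> - {B}))"
            using \<rho> B by (auto simp: pair_partitions_iff partition_on_def disjoint_def disjnt_def)
          moreover have "insert B (\<rho> - {B}) = \<rho>" using B by blast
          ultimately show ?thesis
            using \<rho> partition_on_insert[of B "\<rho> - {B}" "{1..Suc k}"] by (simp add: pair_partitions_iff)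
        qed
        ultimately show ?thesis by simp
      qed
      then have "\<rho> - {B} \<in> pair_partitions ({1..k} - {l})" using \<rho> by (simp add: pair_partitions_iff)
      moreover have "\<rho> = ?ins (l, \<rho> - {B})" using B l by auto
      ultimately show "\<rho> \<in> ?ins ` ?S" using \<open>l \<in> {1..k}\<close> by (intro image_eqI[of _ _ "(l, \<rho> - {B})"]) auto
    qed
  qed
  then have "pfaffian {1..Suc k} ?a = (\<Sum>p\<in>?S. (- 1) ^ crossings (?ins p) * (\<Prod>B\<in>?ins p. ?a (Min B) (Max B)))"
    unfolding pfaffian_def by (rule sum.reindex_bij_betw[symmetric])
  also have "\<dots> = (\<Sum>(l, \<pi>)\<in>?S. (- 1) ^ (l - 1) * ((- 1) ^ crossings \<pi> * (\<Prod>B\<in>\<pi>. a (Min B) (Max B))))"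
  proof (rule sum.cong[OF refl], clarify)
    fix l \<pi> assume *: "l \<in> {1..k}" "\<pi> \<in> pair_partitions ({1..k} - {l})"
    have "finite \<pi>"
      using * by (auto simp: pair_partitions_iff intro: finite_elements)
    moreover have "Max B \<le> k" if "B \<in> \<pi>" for B
    proof -
      have "Max B \<in> B" using that * by (intro Max_in) (auto simp: pair_partitions_iff card_2_iff dest!: bspec)
      moreover have "B \<subseteq> {1..k}" using that * by (auto simp: pair_partitions_iff partition_on_def)
      ultimately show ?thesis by auto
    qed
    ultimately have "(\<Prod>B\<in>insert {l, Suc k} \<pi>. ?a (Min B) (Max B)) = (\<Prod>B\<in>\<pi>. a (Min B) (Max B))"
      using * notin by (subst prod.insert) auto
    then show "(- 1) ^ crossings (insert {l, Suc k} \<pi>) * (\<Prod>B\<in>insert {l, Suc k} \<pi>. ?a (Min B) (Max B)) =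
      (- 1) ^ (l - 1) * ((- 1) ^ crossings \<pi> * (\<Prod>B\<in>\<pi>. a (Min B) (Max B)))"
      using crossings_insert_top[OF *(2,1)] by simp
  qed
  also have "\<dots> = ?L"
    by (subst sum.Sigma[symmetric]) (auto simp: finite_pair_partitions pfaffian_def sum_distrib_left)
  finally show ?thesis ..
qed

section \<open>Paths staying in an open set\<close>

text \<open>For a continuous path this says that it stays in the open set \<open>U\<close> up to time \<open>r\<close>; the
  countable description makes it an event of the product \<open>\<sigma>\<close>-algebra. For \<open>U = UNIV\<close> it is never
  true, as the distance to the empty set is \<open>0\<close>.\<close>

definition stays :: "'a::metric_space set \<Rightarrow> real \<Rightarrow> (real \<Rightarrow> 'a) \<Rightarrow> bool" where
  "stays U r y \<longleftrightarrow>
    (\<exists>n. \<forall>q\<in>{q \<in> \<rat>. 0 \<le> q}. q \<le> r \<longrightarrow> inverse (real (Suc n)) \<le> infdist (y q) (- U))"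

text \<open>The distance to the complement of \<open>U\<close> is continuous along the path. A
  positive bound at the rational times extends to their closure \<open>{0..r}\<close>; conversely,
  by compactness, a path that stays in \<open>U\<close> has a positive minimal distance.\<close>

lemma stays_iff:
  fixes y :: "real \<Rightarrow> 'a::metric_space"
  assumes U: "open U" "U \<noteq> UNIV" and r: "0 \<le> r" and y: "continuous_on {0..} y"
  shows "stays U r y \<longleftrightarrow> (\<forall>s\<in>{0..r}. y s \<in> U)"
proof -
  define g where "g s = infdist (y s) (- U)" for s
  have g: "continuous_on {0..r} g"
    unfolding g_def using y by (intro continuous_on_infdist) (rule continuous_on_subset, auto)
  have pos: "0 < g s \<longleftrightarrow> y s \<in> U" for s
    using in_closed_iff_infdist_zero[of "- U" "y s"] infdist_nonneg[of "y s" "- U"] U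
    by (auto simp: g_def closed_def less_le)
  show ?thesis
  proof
    assume "stays U r y"
    then obtain n where n: "\<And>q. q \<in> \<rat> \<Longrightarrow> 0 \<le> q \<Longrightarrow> q \<le> r \<Longrightarrow> inverse (real (Suc n)) \<le> g q"
      by (auto simp: stays_def g_def)
    have cl: "closure (\<rat> \<inter> {0..r}) = {0..r}"
    proof
      show "{0..r} \<subseteq> closure (\<rat> \<inter> {0..r})"
      proof
        fix s assume s: "s \<in> {0..r}"
        show "s \<in> closure (\<rat> \<inter> {0..r})"
        proof (cases "r = 0")
          case False
          show ?thesis unfolding closure_approachable
          proof (intro allI impI)
            fix e :: real assume "e > 0"
            then have "max 0 (s - e) < min r (s + e)" using s r False by auto
            from Rats_dense_in_real[OF this] obtain q where "q \<in> \<rat>" "max 0 (s - e) < q" "q < min r (s + e)"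
              by auto
            then show "\<exists>q\<in>\<rat> \<inter> {0..r}. dist q s < e"
              by (intro bexI[of _ q]) (auto simp: dist_real_def)
          qed
        qed (use s closure_subset in auto)
      qed
    qed (rule closure_minimal, auto)
    have "inverse (real (Suc n)) \<le> g s" if "s \<in> {0..r}" for s
      by (rule continuous_ge_on_closure[of "\<rat> \<inter> {0..r}"]) (use that g n in \<open>auto simp: cl\<close>)
    moreover have "0 < inverse (real (Suc n))" by simp
    ultimately show "\<forall>s\<in>{0..r}. y s \<in> U" using pos less_le_trans by blast
  next
    assume *: "\<forall>s\<in>{0..r}. y s \<in> U"
    obtain s0 where s0: "s0 \<in> {0..r}" "\<And>s. s \<in> {0..r} \<Longrightarrow> g s0 \<le> g s"
      using continuous_attains_inf[OF compact_Icc _ g] r by auto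
    have "0 < g s0" using * s0 pos by blast
    then obtain n where "inverse (real (Suc n)) < g s0" using reals_Archimedean by blast
    then show "stays U r y"
      unfolding stays_def g_def[symmetric] using s0 by (intro exI[of _ n]) (auto intro: order_trans less_imp_le)
  qed
qed

lemma stays_mono: "stays U r y \<Longrightarrow> r' \<le> r \<Longrightarrow> stays U r' y"
  unfolding stays_def by (meson order_trans)

lemma stays_cong: "(\<And>s. 0 \<le> s \<Longrightarrow> y s = y' s) \<Longrightarrow> stays U r y = stays U r y'"
  by (auto simp: stays_def)

text \<open>The horizon may be random, as is the time remaining after a stopping time. Comparing
  \<open>q\<close> with \<open>f \<omega>\<close> inside the implication keeps the index set of
  rationals deterministic and countable.\<close>

lemma measurable_stays:
  fixes Y :: "real \<Rightarrow> 'w \<Rightarrow> 'a::metric_space"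
  assumes [measurable]: "f \<in> borel_measurable M" and Y: "\<And>s. 0 \<le> s \<Longrightarrow> Y s \<in> borel_measurable M"
  shows "Measurable.pred M (\<lambda>\<omega>. stays U (f \<omega>) (\<lambda>s. Y s \<omega>))"
  unfolding stays_def
proof (intro pred_intros_countable measurable_pred_countable)
  show "countable {q \<in> \<rat>. 0 \<le> (q :: real)}"
    by (rule countable_subset[OF _ countable_rat]) auto
  fix n q assume "q \<in> {q \<in> \<rat>. 0 \<le> (q :: real)}"
  then have [measurable]: "Y q \<in> borel_measurable M" by (intro Y) auto
  have "continuous_on UNIV (\<lambda>z. infdist z (- U))" by (intro continuous_intros)
  then have [measurable]: "(\<lambda>z. infdist z (- U)) \<in> borel_measurable borel"
    by (rule borel_measurable_continuous_onI)
  show "Measurable.pred M (\<lambda>\<omega>. q \<le> f \<omega> \<longrightarrow> inverse (real (Suc n)) \<le> infdist (Y q \<omega>) (- U))"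
    by measurable
qed

section \<open>Exit times and their measurability\<close>

text \<open>The times at which a continuous path is outside the open set form a closed set, which
  contains its infimum.\<close>

lemma exit_time_attained:
  fixes U :: "'v::topological_space set"
  assumes U: "open U" and X: "continuous_on {0..} (\<lambda>s. X s \<omega>)" and fin: "exit_time X U \<omega> < \<infinity>"
  obtains m where "0 \<le> m" "exit_time X U \<omega> = ennreal m" "X m \<omega> \<notin> U" "\<And>s. 0 \<le> s \<Longrightarrow> s < m \<Longrightarrow> X s \<omega> \<in> U"
proof -
  define S where "S = {s. 0 \<le> s \<and> X s \<omega> \<notin> U}"
  have "S \<noteq> {}"
  proof
    assume "S = {}"
    then have "exit_time X U \<omega> = \<infinity>" unfolding exit_time_def S_def by simp
    with fin show False by simp
  qed
  have "S = {0..} \<inter> (\<lambda>s. X s \<omega>) -` (- U)" by (auto simp: S_def)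
  then have "closed S"
    using continuous_closed_preimage[OF X closed_atLeast, of "- U"] U by auto
  have bdd: "bdd_below S" by (auto simp: S_def bdd_below_def)
  define m where "m = Inf S"
  have m: "m \<in> S" unfolding m_def using closed_contains_Inf[OF \<open>S \<noteq> {}\<close> bdd \<open>closed S\<close>] .
  have le: "m \<le> s" if "s \<in> S" for s unfolding m_def using cInf_lower[OF that bdd] .
  have "exit_time X U \<omega> = ennreal m"
    unfolding exit_time_def S_def[symmetric]
    by (rule antisym) (auto intro: INF_lower m INF_greatest ennreal_leI le)
  then show ?thesis
    using that[of m] m le by (force simp: S_def)
qed

lemma exit_time_greater_iff:
  fixes U :: "'v::topological_space set"
  assumes U: "open U" and X: "continuous_on {0..} (\<lambda>s. X s \<omega>)" and t: "0 \<le> t"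
  shows "ennreal t < exit_time X U \<omega> \<longleftrightarrow> (\<forall>s\<in>{0..t}. X s \<omega> \<in> U)"
proof
  assume *: "ennreal t < exit_time X U \<omega>"
  show "\<forall>s\<in>{0..t}. X s \<omega> \<in> U"
  proof (rule ballI, rule ccontr)
    fix s assume s: "s \<in> {0..t}" "X s \<omega> \<notin> U"
    then have "exit_time X U \<omega> \<le> ennreal s" unfolding exit_time_def by (intro INF_lower) auto
    also have "\<dots> \<le> ennreal t" using s by (intro ennreal_leI) auto
    finally show False using * by simp
  qed
next
  assume *: "\<forall>s\<in>{0..t}. X s \<omega> \<in> U"
  show "ennreal t < exit_time X U \<omega>"
  proof (cases "exit_time X U \<omega> < \<infinity>")
    case True
    from exit_time_attained[OF U X True] obtain m where
      "0 \<le> m" "exit_time X U \<omega> = ennreal m" "X m \<omega> \<notin> U" by blast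
    moreover from this * have "t < m" by force
    ultimately show ?thesis using t by (simp add: ennreal_less_iff)
  qed (auto simp: less_top[symmetric])
qed

text \<open>The exit time itself need not be a stopping time of the uncompleted filtration, because
  only almost all paths are continuous.\<close>

definition stay_time :: "'a::metric_space set \<Rightarrow> (real \<Rightarrow> 'a) \<Rightarrow> ennreal" where
  "stay_time U y = Inf (ennreal ` {r. 0 \<le> r \<and> \<not> stays U r y})"

lemma stay_time_eq_exit_time:
  fixes X :: "real \<Rightarrow> 'w \<Rightarrow> 'v::metric_space"
  assumes U: "open U" "U \<noteq> UNIV" and X: "continuous_on {0..} (\<lambda>s. X s \<omega>)"
  shows "stay_time U (\<lambda>s. X s \<omega>) = exit_time X U \<omega>"
  unfolding stay_time_def exit_time_def
proof (rule antisym)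
  show "Inf (ennreal ` {r. 0 \<le> r \<and> \<not> stays U r (\<lambda>s. X s \<omega>)}) \<le> Inf (ennreal ` {t. 0 \<le> t \<and> X t \<omega> \<notin> U})"
    by (rule INF_superset_mono) (auto simp: stays_iff[OF U _ X])
  show "Inf (ennreal ` {t. 0 \<le> t \<and> X t \<omega> \<notin> U}) \<le> Inf (ennreal ` {r. 0 \<le> r \<and> \<not> stays U r (\<lambda>s. X s \<omega>)})"
  proof (rule INF_greatest)
    fix r assume "r \<in> {r. 0 \<le> r \<and> \<not> stays U r (\<lambda>s. X s \<omega>)}"
    then obtain s where "0 \<le> s" "s \<le> r" "X s \<omega> \<notin> U" by (auto simp: stays_iff[OF U _ X])
    then show "Inf (ennreal ` {t. 0 \<le> t \<and> X t \<omega> \<notin> U}) \<le> ennreal r"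
      by (intro INF_lower2[of s]) (auto intro: ennreal_leI)
  qed
qed

text \<open>For a discontinuous path the infimum need not be attained, so
  \<open>stay_time \<le> u\<close> is tested at rational times \<open>q\<close> in
  \<open>(u, v)\<close>. This shows that the event belongs to the natural filtration at every
  \<open>v > u\<close>, hence to the right-continuous one at \<open>u\<close>.\<close>

lemma stopping_time_stay_time:
  fixes X :: "real \<Rightarrow> 'w \<Rightarrow> real ^ 'k::finite"
  shows "stopping_time (right_filtration M X) (\<lambda>\<omega>. stay_time U (\<lambda>s. X s \<omega>))"
proof (rule stopping_timeI)
  fix u :: ennreal
  have le_iff: "stay_time U y \<le> u \<longleftrightarrow> (\<forall>q\<in>{q \<in> \<rat>. 0 \<le> q \<and> u < ennreal q \<and> ennreal q < v}. \<not> stays U q y)"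
    if uv: "u < v" for v and y :: "real \<Rightarrow> real ^ 'k"
  proof
    assume le: "stay_time U y \<le> u"
    show "\<forall>q\<in>{q \<in> \<rat>. 0 \<le> q \<and> u < ennreal q \<and> ennreal q < v}. \<not> stays U q y"
    proof
      fix q assume "q \<in> {q \<in> \<rat>. 0 \<le> q \<and> u < ennreal q \<and> ennreal q < v}"
      then have "stay_time U y < ennreal q" "0 \<le> q" using le by auto
      then obtain r where "0 \<le> r" "\<not> stays U r y" "ennreal r < ennreal q"
        unfolding stay_time_def INF_less_iff by auto
      then show "\<not> stays U q y" using stays_mono[of U q y r] by (auto simp: ennreal_less_iff)
    qed
  next
    assume *: "\<forall>q\<in>{q \<in> \<rat>. 0 \<le> q \<and> u < ennreal q \<and> ennreal q < v}. \<not> stays U q y"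
    show "stay_time U y \<le> u"
    proof (rule dense_ge_bounded[OF uv])
      fix w assume w: "u < w" "w < v"
      obtain a where a: "u = ennreal a" "0 \<le> a" using w by (cases u) auto
      obtain b where b: "w = ennreal b" "0 \<le> b" using w by (cases w) auto
      have "a < b" using w a b by (simp add: ennreal_less_iff)
      then obtain q where q: "q \<in> \<rat>" "a < q" "q < b" using Rats_dense_in_real by blast
      then have "u < ennreal q" "ennreal q < w" using a b by (auto simp: ennreal_less_iff)
      with q a w * have "0 \<le> q" "\<not> stays U q y" by auto
      then have "stay_time U y \<le> ennreal q" unfolding stay_time_def by (intro INF_lower) auto
      then show "stay_time U y \<le> w" using \<open>ennreal q < w\<close> by auto
    qed
  qed
  have nat: "Measurable.pred (natural_filtration M X v) (\<lambda>\<omega>. stay_time U (\<lambda>s. X s \<omega>) \<le> u)" if "u < v" for v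
    unfolding le_iff[OF that]
  proof (rule measurable_pred_countable)
    show "countable {q \<in> \<rat>. 0 \<le> q \<and> u < ennreal q \<and> ennreal q < v}"
      by (rule countable_subset[OF _ countable_rat]) auto
    fix q assume "q \<in> {q \<in> \<rat>. 0 \<le> q \<and> u < ennreal q \<and> ennreal q < v}"
    then have q: "0 \<le> q" "ennreal q < v" by auto
    \<comment> \<open>Stopping the process at \<open>q\<close> makes all its values known at time
      \<open>v\<close> and leaves \<open>stays U q\<close> unchanged.\<close>
    define Y where "Y s = X (min q s)" for s
    have "Y s \<in> borel_measurable (natural_filtration M X v)" if "0 \<le> s" for s
    proof (rule measurableI)
      fix B :: "(real ^ 'k) set" assume B: "B \<in> sets borel"
      have "0 \<le> min q s" "ennreal (min q s) \<le> v"
        using q that by (auto intro!: order_trans[OF ennreal_leI less_imp_le[OF q(2)]])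
      then show "Y s -` B \<inter> space (natural_filtration M X v) \<in> sets (natural_filtration M X v)"
        unfolding space_natural_filtration unfolding natural_filtration_def Y_def
        using B by (subst sets_measure_of) (auto intro!: sigma_sets.Basic exI[of _ "min q s"] exI[of _ B])
    qed simp
    then have "Measurable.pred (natural_filtration M X v) (\<lambda>\<omega>. stays U q (\<lambda>s. Y s \<omega>))"
      by (intro measurable_stays) auto
    moreover have "stays U q (\<lambda>s. Y s \<omega>) = stays U q (\<lambda>s. X s \<omega>)" for \<omega>
      unfolding stays_def Y_def by (auto simp: min_absorb2)
    ultimately show "Measurable.pred (natural_filtration M X v) (\<lambda>\<omega>. \<not> stays U q (\<lambda>s. X s \<omega>))"
      by (simp add: pred_intros_logic)
  qed
  show "Measurable.pred (right_filtration M X u) (\<lambda>\<omega>. stay_time U (\<lambda>s. X s \<omega>) \<le> u)"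
  proof (cases "u = \<infinity>")
    case False
    then have lt: "u < \<infinity>" by (simp add: less_top)
    have "Measurable.pred (natural_filtration M X v) (\<lambda>\<omega>. stay_time U (\<lambda>s. X s \<omega>) \<le> u)" if "u < v \<or> v = \<infinity>" for v
      using nat lt that by blast
    then show ?thesis by (auto simp: pred_def sets_right_filtration)
  qed auto
qed

section \<open>Reflection at a stopping time\<close>

lemma emeasure_completion_eq_AE:
  assumes E: "E \<in> sets N" "E' \<subseteq> space N" and ae: "AE \<omega> in N. \<omega> \<in> E' \<longleftrightarrow> \<omega> \<in> E"
  shows "E' \<in> sets (completion N)" "emeasure (completion N) E' = emeasure N E"
proof -
  from ae obtain N0 where N0: "N0 \<in> null_sets N" "\<And>\<omega>. \<omega> \<in> space N \<Longrightarrow> \<omega> \<notin> N0 \<Longrightarrow> \<omega> \<in> E' \<longleftrightarrow> \<omega> \<in> E"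
    by (auto elim!: AE_E3)
  have "E' = (E - N0) \<union> (E' \<inter> N0)" using N0(2) E sets.sets_into_space[of E N] by blast
  then show E': "E' \<in> sets (completion N)"
    by (rule sets_completionI[of _ _ _ N0]) (use E N0 in auto)
  have "emeasure (completion N) E' = emeasure (completion N) E"
    by (rule emeasure_eq_AE) (use E E' ae in \<open>auto intro: AE_completion\<close>)
  then show "emeasure (completion N) E' = emeasure N E"
    using E by simp
qed

lemma prob_of_eq_AE:
  assumes E: "{\<omega>\<in>space N. E \<omega>} \<in> sets N" and ae: "AE \<omega> in N. E' \<omega> \<longleftrightarrow> E \<omega>"
  shows "prob_of N E' = measure N {\<omega>\<in>space N. E \<omega>}"
proof -
  have "AE \<omega> in N. \<omega> \<in> {\<omega>\<in>space N. E' \<omega>} \<longleftrightarrow> \<omega> \<in> {\<omega>\<in>space N. E \<omega>}"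
    using ae by (rule AE_mp) auto
  from emeasure_completion_eq_AE(2)[OF E _ this] show ?thesis
    by (simp add: prob_of_def measure_def)
qed

lemma measurable_trajectory:
  fixes Z :: "real \<Rightarrow> 'w \<Rightarrow> real ^ 'k::finite"
  assumes "\<And>s. 0 \<le> s \<Longrightarrow> Z s \<in> borel_measurable M"
  shows "trajectory Z \<in> M \<rightarrow>\<^sub>M path_space"
  unfolding trajectory_def[abs_def] path_space_def using assms by (intro measurable_restrict) auto

lemma sets_right_filtration_subset:
  assumes X: "\<And>s. 0 \<le> s \<Longrightarrow> X s \<in> borel_measurable M"
  shows "sets (right_filtration M X u) \<subseteq> sets M"
proof -
  have "sets (natural_filtration M X \<infinity>) \<subseteq> sets M"
    unfolding natural_filtration_def using X measurable_sets
    by (subst sets_measure_of) (auto intro!: sets.sigma_sets_subset)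
  then show ?thesis by (auto simp: sets_right_filtration)
qed

text \<open>The random time is approximated from above by multiples of \<open>1 / Suc n\<close>.
  Each approximation takes countably many values, and continuity of the paths gives the
  limit.\<close>

lemma measurable_at_random_time:
  fixes Y :: "real \<Rightarrow> 'w \<Rightarrow> 'a::metric_space"
  assumes Y: "\<And>s. 0 \<le> s \<Longrightarrow> Y s \<in> borel_measurable M"
    and cont: "\<And>\<omega>. \<omega> \<in> space M \<Longrightarrow> continuous_on {0..} (\<lambda>s. Y s \<omega>)"
    and f[measurable]: "f \<in> borel_measurable M" and f0: "\<And>\<omega>. \<omega> \<in> space M \<Longrightarrow> 0 \<le> f \<omega>"
  shows "(\<lambda>\<omega>. Y (f \<omega>) \<omega>) \<in> borel_measurable M"
proof (rule borel_measurable_LIMSEQ_metric)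
  define g where "g n \<omega> = nat \<lceil>real (Suc n) * f \<omega>\<rceil>" for n \<omega>
  let ?u = "\<lambda>n \<omega>. Y (real (g n \<omega>) / real (Suc n)) \<omega>"
  show "?u n \<in> borel_measurable M" for n
  proof (rule measurable_compose_countable[where g = "g n" and f = "\<lambda>i. Y (real i / real (Suc n))"])
    show "Y (real i / real (Suc n)) \<in> borel_measurable M" for i by (intro Y) simp
    show "g n \<in> M \<rightarrow>\<^sub>M count_space UNIV" unfolding g_def[abs_def] by measurable
  qed
  fix \<omega> assume \<omega>: "\<omega> \<in> space M"
  have "(\<lambda>n. real (g n \<omega>) / real (Suc n)) \<longlonglongrightarrow> f \<omega>"
  proof (rule real_tendsto_sandwich)
    have g: "real (Suc n) * f \<omega> \<le> real (g n \<omega>)" "real (g n \<omega>) \<le> real (Suc n) * f \<omega> + 1" for n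
    proof -
      have "0 \<le> real (Suc n) * f \<omega>" using f0[OF \<omega>] by simp
      then have "0 \<le> \<lceil>real (Suc n) * f \<omega>\<rceil>" by linarith
      then have "real (g n \<omega>) = of_int \<lceil>real (Suc n) * f \<omega>\<rceil>" unfolding g_def by (rule of_nat_nat)
      then show "real (Suc n) * f \<omega> \<le> real (g n \<omega>)" "real (g n \<omega>) \<le> real (Suc n) * f \<omega> + 1"
        using ceiling_correct[of "real (Suc n) * f \<omega>"] by linarith+
    qed
    show "\<forall>\<^sub>F n in sequentially. f \<omega> \<le> real (g n \<omega>) / real (Suc n)"
      using g(1) by (simp add: pos_le_divide_eq mult.commute)
    show "\<forall>\<^sub>F n in sequentially. real (g n \<omega>) / real (Suc n) \<le> f \<omega> + 1 / real (Suc n)"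
    proof (intro always_eventually allI)
      fix n
      show "real (g n \<omega>) / real (Suc n) \<le> f \<omega> + 1 / real (Suc n)"
        using g(2)[of n] by (simp add: pos_divide_le_eq ring_distribs mult.commute del: of_nat_Suc)
    qed
    show "(\<lambda>n. f \<omega> + 1 / real (Suc n)) \<longlonglongrightarrow> f \<omega>"
      using tendsto_add[OF tendsto_const[of "f \<omega>"] LIMSEQ_inverse_real_of_nat] by (simp add: inverse_eq_divide)
  qed simp
  then show "(\<lambda>n. ?u n \<omega>) \<longlonglongrightarrow> Y (f \<omega>) \<omega>"
    using f0[OF \<omega>] by (intro continuous_on_tendsto_compose[OF cont[OF \<omega>]]) auto
qed

text \<open>Replacing \<open>X\<close> by a version \<open>Y\<close> all of whose paths are continuous would change the
  filtration, so stopping times refer to \<open>X\<close>. Events are expressed by \<open>Y\<close>, which makes them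
  measurable without completion.\<close>

locale reflectable_start =
  fixes W :: "(real ^ 'k::finite \<Rightarrow> real ^ 'k) set" and M :: "'w measure"
    and P :: "real ^ 'k \<Rightarrow> 'w measure" and X :: "real \<Rightarrow> 'w \<Rightarrow> real ^ 'k"
    and x :: "real ^ 'k" and N0 :: "'w set"
  assumes reflectable_X: "reflectable W M P X"
    and N0: "N0 \<in> null_sets (P x)"
    and good: "\<And>\<omega>. \<omega> \<in> space M \<Longrightarrow> \<omega> \<notin> N0 \<Longrightarrow> X 0 \<omega> = x \<and> continuous_on {0..} (\<lambda>t. X t \<omega>)"
begin

text \<open>The constant path \<open>x\<close> on the exceptional set is continuous and, for
  \<open>x\<close> in the alcove, stays in every region. Thus identities between events before and
  after the exit hold there as well.\<close>

definition Y :: "real \<Rightarrow> 'w \<Rightarrow> real ^ 'k" where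
  "Y t \<omega> = (if \<omega> \<in> N0 then x else X t \<omega>)"

lemma sets_P [measurable_cong, simp]: "sets (P z) = sets M"
  and space_P [simp]: "space (P z) = space M"
  and prob_space_P: "prob_space (P z)"
  and X_meas: "0 \<le> s \<Longrightarrow> X s \<in> borel_measurable M"
  using reflectable_X sets_eq_imp_space_eq[of "P z" M] by (auto simp: reflectable_def)

sublocale prob_space "P x" by (rule prob_space_P)

lemma AE_good: "AE \<omega> in P x. \<omega> \<notin> N0"
  using N0 by (rule AE_not_in)

lemma AE_goodI: "(\<And>\<omega>. \<omega> \<in> space M \<Longrightarrow> \<omega> \<notin> N0 \<Longrightarrow> Q \<omega>) \<Longrightarrow> AE \<omega> in P x. Q \<omega>"
  by (rule AE_mp[OF AE_good]) auto

lemma Y_cont: "\<omega> \<in> space M \<Longrightarrow> continuous_on {0..} (\<lambda>s. Y s \<omega>)"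
  using good by (cases "\<omega> \<in> N0") (auto simp: Y_def)

lemma Y_eq: "\<omega> \<notin> N0 \<Longrightarrow> Y s \<omega> = X s \<omega>"
  by (simp add: Y_def)

lemma Y_meas: "0 \<le> s \<Longrightarrow> Y s \<in> borel_measurable M"
proof -
  assume [measurable]: "0 \<le> s"
  have [measurable]: "N0 \<in> sets M" using N0 by auto
  have [measurable]: "X s \<in> borel_measurable M" using X_meas \<open>0 \<le> s\<close> by simp
  show ?thesis unfolding Y_def[abs_def] by measurable
qed

text \<open>Invariance carries the law from \<open>z\<close> to the law from \<open>s z\<close>,
  which is the same point. The map on paths is restricted to nonnegative times because elements of
  the product space are extensional.\<close>

lemma law_reflect:
  assumes s: "s \<in> W" "continuous_on UNIV s" "s z = z" and B: "B \<in> sets path_space"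
  shows "emeasure (law (P z) X) ((\<lambda>y. \<lambda>r\<in>{0..}. s (y r)) -` B \<inter> space path_space) = emeasure (law (P z) X) B"
proof -
  let ?S = "\<lambda>y. \<lambda>r\<in>{0..}. s (y r)"
  have [measurable]: "s \<in> borel_measurable borel" using s(2) by (rule borel_measurable_continuous_onI)
  have S: "?S \<in> path_space \<rightarrow>\<^sub>M path_space"
    unfolding path_space_def by (intro measurable_restrict) measurable
  have X: "trajectory X \<in> P z \<rightarrow>\<^sub>M path_space"
    by (intro measurable_trajectory) (simp add: X_meas measurable_cong_sets[OF sets_P])
  have "law (P z) X = law (P z) (\<lambda>t \<omega>. s (X t \<omega>))"
    using reflectable_X s by (auto simp: reflectable_def)
  also have "\<dots> = distr (law (P z) X) path_space ?S"
  proof -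
    have "trajectory (\<lambda>t \<omega>. s (X t \<omega>)) = ?S \<circ> trajectory X"
      by (auto simp: fun_eq_iff trajectory_def)
    then show ?thesis unfolding law_def by (simp add: distr_distr[OF S X])
  qed
  finally have "emeasure (law (P z) X) B = emeasure (distr (law (P z) X) path_space ?S) B" by simp
  also have "\<dots> = emeasure (law (P z) X) (?S -` B \<inter> space path_space)"
    using S B by (subst emeasure_distr) (auto simp: law_def)
  finally show ?thesis ..
qed

lemma measurable_shifted_Y:
  assumes [measurable]: "T \<in> borel_measurable M"
  shows "(\<lambda>\<omega>. trajectory (\<lambda>s. Y (enn2real (T \<omega>) + s)) \<omega>) \<in> M \<rightarrow>\<^sub>M path_space"
  unfolding trajectory_def path_space_def
proof (rule measurable_restrict)
  fix s :: real assume s: "s \<in> {0..}"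
  show "(\<lambda>\<omega>. Y (enn2real (T \<omega>) + s) \<omega>) \<in> M \<rightarrow>\<^sub>M borel"
    by (rule measurable_at_random_time) (use s in \<open>auto intro: Y_meas Y_cont\<close>)
qed

text \<open>On the left, replacing \<open>X\<close> by \<open>Y\<close> changes the event by a null
  set and makes it measurable without completion. The integral on the right keeps \<open>X\<close>
  and the completed measure.\<close>

lemma strong_markov_Y:
  assumes T: "stopping_time (right_filtration M X) T"
    and A: "A \<in> sets (filtration.pre_sigma (space M) (right_filtration M X) T)"
    and fin: "\<And>\<omega>. \<omega> \<in> A \<Longrightarrow> T \<omega> < \<infinity>"
    and B: "B \<in> sets path_space"
    and Am: "A \<in> sets M" and Tm: "T \<in> borel_measurable M"
  shows "emeasure (P x) {\<omega>\<in>A. trajectory (\<lambda>s. Y (enn2real (T \<omega>) + s)) \<omega> \<in> B} =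
    (\<integral>\<^sup>+\<omega>. emeasure (law (P (X (enn2real (T \<omega>)) \<omega>)) X) B * indicator A \<omega> \<partial>completion (P x))"
proof -
  let ?E' = "{\<omega>\<in>A. T \<omega> < \<infinity> \<and> trajectory (\<lambda>s. X (enn2real (T \<omega>) + s)) \<omega> \<in> B}"
  let ?E = "{\<omega>\<in>A. trajectory (\<lambda>s. Y (enn2real (T \<omega>) + s)) \<omega> \<in> B}"
  have "?E = A \<inter> ((\<lambda>\<omega>. trajectory (\<lambda>s. Y (enn2real (T \<omega>) + s)) \<omega>) -` B \<inter> space M)"
    using sets.sets_into_space[OF Am] by auto
  then have E: "?E \<in> sets (P x)" using Am measurable_sets[OF measurable_shifted_Y[OF Tm] B] by simp
  have ae: "AE \<omega> in P x. \<omega> \<in> ?E' \<longleftrightarrow> \<omega> \<in> ?E"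
    using fin by (intro AE_goodI) (auto simp: trajectory_def Y_eq)
  have "emeasure (P x) ?E = emeasure (completion (P x)) ?E'"
    by (rule emeasure_completion_eq_AE(2)[OF E _ ae, symmetric]) (use sets.sets_into_space[OF Am] in auto)
  also have "\<dots> = (\<integral>\<^sup>+\<omega>\<in>{\<omega>\<in>A. T \<omega> < \<infinity>}. emeasure (law (P (X (enn2real (T \<omega>)) \<omega>)) X) B \<partial>completion (P x))"
    using reflectable_X T A B unfolding reflectable_def strong_markov_def by blast
  also have "{\<omega>\<in>A. T \<omega> < \<infinity>} = A" using fin by auto
  finally show ?thesis .
qed

lemma filtration_X: "filtration (space M) (right_filtration M X)"
  by (rule filtration_right_filtration)

lemma stopping_time_meas: "stopping_time (right_filtration M X) T \<Longrightarrow> T \<in> borel_measurable M"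
  by (rule measurable_stopping_time[where F = "right_filtration M X"])
    (use sets_right_filtration_subset[of X M] X_meas in auto)

lemma pre_sigma_subset:
  assumes "stopping_time (right_filtration M X) T"
  shows "sets (filtration.pre_sigma (space M) (right_filtration M X) T) \<subseteq> sets M"
proof
  fix A assume "A \<in> sets (filtration.pre_sigma (space M) (right_filtration M X) T)"
  from filtration.sets_pre_sigmaD[OF filtration_X assms this, of \<infinity>] show "A \<in> sets M"
    using sets_right_filtration_subset[of X M] X_meas by auto
qed

text \<open>At time \<open>T\<close> the path sits on the mirror, and the law started from a point
  of the mirror is invariant under \<open>s\<close>. Hence, on \<open>A\<close>, the later path and
  its mirror image have the same joint law with \<open>T\<close>.\<close>

lemma reflection_principle:
  assumes T: "stopping_time (right_filtration M X) T"
    and A: "A \<in> sets (filtration.pre_sigma (space M) (right_filtration M X) T)"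
    and le: "\<And>\<omega>. \<omega> \<in> A \<Longrightarrow> T \<omega> \<le> ennreal t" and t: "0 \<le> t"
    and s: "s \<in> W" "continuous_on UNIV s"
    and inv: "\<And>\<omega>. \<omega> \<in> A \<Longrightarrow> \<omega> \<notin> N0 \<Longrightarrow> s (X (enn2real (T \<omega>)) \<omega>) = X (enn2real (T \<omega>)) \<omega>"
    and U: "open U" "U \<noteq> UNIV"
  shows "measure (P x) {\<omega>\<in>A. \<forall>r\<in>{enn2real (T \<omega>)..t}. s (Y r \<omega>) \<in> U} =
    measure (P x) {\<omega>\<in>A. \<forall>r\<in>{enn2real (T \<omega>)..t}. Y r \<omega> \<in> U}"
proof -
  let ?\<tau> = "\<lambda>\<omega>. enn2real (T \<omega>)"
  define K where "K \<omega> = trajectory (\<lambda>r. Y (?\<tau> \<omega> + r)) \<omega>" for \<omega>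
  define S :: "(real \<Rightarrow> real ^ 'k) \<Rightarrow> real \<Rightarrow> real ^ 'k" where "S = (\<lambda>y. \<lambda>r\<in>{0..}. s (y r))"
  have Am: "A \<in> sets M" using A pre_sigma_subset[OF T] by auto
  have Tm[measurable]: "T \<in> borel_measurable M" using T by (rule stopping_time_meas)
  have [measurable]: "s \<in> borel_measurable borel" using s(2) by (rule borel_measurable_continuous_onI)
  have S[measurable]: "S \<in> path_space \<rightarrow>\<^sub>M path_space"
    unfolding path_space_def S_def by (intro measurable_restrict) measurable
  have K[measurable]: "K \<in> M \<rightarrow>\<^sub>M path_space"
    unfolding K_def by (rule measurable_shifted_Y[OF Tm])
  \<comment> \<open>The remaining time \<open>t - T\<close> is random, so the joint laws of \<open>T\<close> and the path after \<open>T\<close> are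
    compared; the strong Markov property gives their agreement on rectangles.\<close>
  let ?D = "density (P x) (indicator A)"
  define \<nu> where "\<nu> F = distr ?D (borel \<Otimes>\<^sub>M path_space) (\<lambda>\<omega>. (?\<tau> \<omega>, F (K \<omega>)))"
    for F :: "(real \<Rightarrow> real ^ 'k) \<Rightarrow> real \<Rightarrow> real ^ 'k"
  have \<nu>: "emeasure (\<nu> F) E = emeasure (P x) {\<omega>\<in>A. (?\<tau> \<omega>, F (K \<omega>)) \<in> E}"
    if F[measurable]: "F \<in> path_space \<rightarrow>\<^sub>M path_space" and E[measurable]: "E \<in> sets (borel \<Otimes>\<^sub>M path_space)" for F E
  proof -
    let ?Z = "(\<lambda>\<omega>. (?\<tau> \<omega>, F (K \<omega>))) -` E \<inter> space M"
    have Z: "(\<lambda>\<omega>. (?\<tau> \<omega>, F (K \<omega>))) \<in> M \<rightarrow>\<^sub>M borel \<Otimes>\<^sub>M path_space" by measurable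
    have "emeasure (\<nu> F) E = emeasure ?D ?Z"
      unfolding \<nu>_def using Z E by (subst emeasure_distr) (auto simp: measurable_cong_sets[OF sets_P])
    also have "\<dots> = emeasure (P x) (A \<inter> ?Z)"
      using Am measurable_sets[OF Z E] by (subst emeasure_density) (auto simp: nn_integral_indicator_singleton intro: arg_cong indicator_inter_arith[symmetric] simp flip: indicator_inter_arith)
    also have "A \<inter> ?Z = {\<omega>\<in>A. (?\<tau> \<omega>, F (K \<omega>)) \<in> E}" using sets.sets_into_space[OF Am] by auto
    finally show ?thesis .
  qed
  have eq: "\<nu> S = \<nu> (\<lambda>y. y)"
  proof (rule measure_eqI_generator_eq)
    let ?G = "{a \<times> b | a b. a \<in> sets (borel :: real measure) \<and> b \<in> sets (path_space :: (real \<Rightarrow> real ^ 'k) measure)}"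
    let ?\<Omega> = "UNIV \<times> space (path_space :: (real \<Rightarrow> real ^ 'k) measure)"
    show "Int_stable ?G" using Int_stable_pair_measure_generator .
    show "?G \<subseteq> Pow ?\<Omega>" using pair_measure_closed[of "borel :: real measure" path_space] by simp
    show "sets (\<nu> S) = sigma_sets ?\<Omega> ?G" "sets (\<nu> (\<lambda>y. y)) = sigma_sets ?\<Omega> ?G"
      by (auto simp: \<nu>_def sets_pair_measure)
    show "range (\<lambda>_::nat. ?\<Omega>) \<subseteq> ?G"
    proof (rule image_subsetI)
      show "?\<Omega> \<in> ?G" by (intro CollectI exI[of _ UNIV] exI[of _ "space path_space"]) simp
    qed
    show "emeasure (\<nu> S) ?\<Omega> \<noteq> \<infinity>"
      by (subst \<nu>) (auto simp: emeasure_finite)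
    fix E assume "E \<in> ?G"
    then obtain C B where E: "E = C \<times> B" and C[measurable]: "C \<in> sets borel" and B[measurable]: "B \<in> sets path_space"
      by auto
    \<comment> \<open>The condition on \<open>T\<close> is absorbed into the event, which remains in
      the \<sigma>-algebra at \<open>T\<close>; the strong Markov property then applies to the
      condition on the later path alone.\<close>
    define A' where "A' = {\<omega>\<in>A. ?\<tau> \<omega> \<in> C}"
    have A': "A' \<in> sets (filtration.pre_sigma (space M) (right_filtration M X) T)"
    proof -
      have "?\<tau> \<in> borel_measurable (filtration.pre_sigma (space M) (right_filtration M X) T)"
        using filtration.measurable_stopping_time_pre_sigma[OF filtration_X T] by measurable
      from A measurable_sets[OF this C]
      have "A \<inter> (?\<tau> -` C \<inter> space (filtration.pre_sigma (space M) (right_filtration M X) T)) \<in>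
        sets (filtration.pre_sigma (space M) (right_filtration M X) T)" by (rule sets.Int)
      also have "A \<inter> (?\<tau> -` C \<inter> space (filtration.pre_sigma (space M) (right_filtration M X) T)) = A'"
        using sets.sets_into_space[OF Am] by (auto simp: A'_def filtration.space_pre_sigma[OF filtration_X])
      finally show ?thesis .
    qed
    have A'm: "A' \<in> sets M" using A' pre_sigma_subset[OF T] by auto
    have fin: "T \<omega> < \<infinity>" if "\<omega> \<in> A'" for \<omega>
      using le[of \<omega>] that by (auto simp: A'_def intro: le_less_trans)
    let ?B' = "S -` B \<inter> space path_space"
    have B': "?B' \<in> sets path_space" using S B by (rule measurable_sets)
    have K_space: "K \<omega> \<in> space path_space" for \<omega>
      by (simp add: K_def trajectory_def path_space_def space_PiM)
    have "emeasure (\<nu> S) E = emeasure (P x) {\<omega>\<in>A'. K \<omega> \<in> ?B'}"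
      using K_space by (subst \<nu>) (auto simp: E A'_def intro!: arg_cong[where f = "emeasure _"])
    also have "\<dots> = (\<integral>\<^sup>+\<omega>. emeasure (law (P (X (?\<tau> \<omega>) \<omega>)) X) ?B' * indicator A' \<omega> \<partial>completion (P x))"
      unfolding K_def by (rule strong_markov_Y[OF T A' fin B' A'm Tm])
    also have "\<dots> = (\<integral>\<^sup>+\<omega>. emeasure (law (P (X (?\<tau> \<omega>) \<omega>)) X) B * indicator A' \<omega> \<partial>completion (P x))"
    proof (rule nn_integral_cong_AE, rule AE_completion, rule AE_goodI)
      fix \<omega> assume "\<omega> \<notin> N0"
      show "emeasure (law (P (X (?\<tau> \<omega>) \<omega>)) X) ?B' * indicator A' \<omega> =
        emeasure (law (P (X (?\<tau> \<omega>) \<omega>)) X) B * indicator A' \<omega>"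
      proof (cases "\<omega> \<in> A'")
        case True
        then have "s (X (?\<tau> \<omega>) \<omega>) = X (?\<tau> \<omega>) \<omega>" using inv \<open>\<omega> \<notin> N0\<close> by (auto simp: A'_def)
        from law_reflect[OF s this B] show ?thesis by (simp add: S_def)
      qed simp
    qed
    also have "\<dots> = emeasure (P x) {\<omega>\<in>A'. K \<omega> \<in> B}"
      unfolding K_def by (rule strong_markov_Y[OF T A' fin B A'm Tm, symmetric])
    also have "\<dots> = emeasure (\<nu> (\<lambda>y. y)) E"
      by (subst \<nu>) (auto simp: E A'_def intro!: arg_cong[where f = "emeasure _"])
    finally show "emeasure (\<nu> S) E = emeasure (\<nu> (\<lambda>y. y)) E" .
  qed auto
  \<comment> \<open>The event to be compared, as one set of pairs (exit time, later path): the path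
    stays in \<open>U\<close> for the remaining time, which is nonnegative on \<open>A\<close> by
    \<open>le\<close>.\<close>
  let ?E = "{p \<in> space (borel \<Otimes>\<^sub>M (path_space :: (real \<Rightarrow> real ^ 'k) measure)). stays U (t - fst p) (snd p)}"
  have coord: "(\<lambda>p :: real \<times> (real \<Rightarrow> real ^ 'k). snd p r) \<in> borel_measurable (borel \<Otimes>\<^sub>M path_space)" if "0 \<le> r" for r :: real
    unfolding path_space_def
    by (rule measurable_compose[OF measurable_snd measurable_component_singleton]) (use that in auto)
  have E: "?E \<in> sets (borel \<Otimes>\<^sub>M path_space)"
    using measurable_stays[of "\<lambda>p. t - fst p" "borel \<Otimes>\<^sub>M path_space" "\<lambda>r p. snd p r" U] coord
    by (simp add: pred_def)
  have stays_K: "stays U (t - ?\<tau> \<omega>) (\<lambda>r\<in>{0..}. f (K \<omega> r)) \<longleftrightarrow> (\<forall>r\<in>{?\<tau> \<omega>..t}. f (Y r \<omega>) \<in> U)"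
    if "\<omega> \<in> A" and f: "continuous_on UNIV f" for \<omega> and f :: "real ^ 'k \<Rightarrow> real ^ 'k"
  proof -
    have \<omega>: "\<omega> \<in> space M" using sets.sets_into_space[OF Am] that by auto
    have \<tau>: "0 \<le> ?\<tau> \<omega>" "?\<tau> \<omega> \<le> t" using le[OF that(1)] t by (auto simp: enn2real_leI)
    have "stays U (t - ?\<tau> \<omega>) (\<lambda>r\<in>{0..}. f (K \<omega> r)) \<longleftrightarrow> stays U (t - ?\<tau> \<omega>) (\<lambda>r. f (Y (?\<tau> \<omega> + r) \<omega>))"
      by (rule stays_cong) (simp add: K_def trajectory_def)
    also have "\<dots> \<longleftrightarrow> (\<forall>r\<in>{0..t - ?\<tau> \<omega>}. f (Y (?\<tau> \<omega> + r) \<omega>) \<in> U)"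
    proof (rule stays_iff[OF U])
      have "continuous_on {0..} (\<lambda>r. Y (?\<tau> \<omega> + r) \<omega>)"
        using \<tau> by (intro continuous_on_compose2[OF Y_cont[OF \<omega>]] continuous_intros) auto
      then show "continuous_on {0..} (\<lambda>r. f (Y (?\<tau> \<omega> + r) \<omega>))"
        by (rule continuous_on_compose2[OF f]) auto
    qed (use \<tau> in auto)
    also have "\<dots> \<longleftrightarrow> (\<forall>r\<in>{?\<tau> \<omega>..t}. f (Y r \<omega>) \<in> U)"
    proof
      assume *: "\<forall>r\<in>{0..t - ?\<tau> \<omega>}. f (Y (?\<tau> \<omega> + r) \<omega>) \<in> U"
      show "\<forall>r\<in>{?\<tau> \<omega>..t}. f (Y r \<omega>) \<in> U"
      proof
        fix r assume "r \<in> {?\<tau> \<omega>..t}"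
        then show "f (Y r \<omega>) \<in> U" using *[rule_format, of "r - ?\<tau> \<omega>"] by auto
      qed
    qed auto
    finally show ?thesis .
  qed
  have K_ext: "(\<lambda>r\<in>{0..}. K \<omega> r) = K \<omega>" for \<omega> by (auto simp: K_def trajectory_def)
  have K_space: "K \<omega> \<in> space path_space" "S (K \<omega>) \<in> space path_space" for \<omega>
    by (simp_all add: K_def S_def trajectory_def path_space_def space_PiM)
  have "emeasure (P x) {\<omega>\<in>A. \<forall>r\<in>{?\<tau> \<omega>..t}. s (Y r \<omega>) \<in> U} = emeasure (\<nu> S) ?E"
    using stays_K[OF _ s(2)] K_space E by (subst \<nu>) (auto simp: S_def[symmetric] S_def[THEN fun_cong] space_pair_measure intro!: arg_cong[where f = "emeasure _"])
  also have "\<dots> = emeasure (P x) {\<omega>\<in>A. \<forall>r\<in>{?\<tau> \<omega>..t}. Y r \<omega> \<in> U}"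
    unfolding eq using stays_K[OF _ continuous_on_id] K_space E
    by (subst \<nu>) (auto simp: K_ext space_pair_measure intro!: arg_cong[where f = "emeasure _"])
  finally show ?thesis by (simp add: measure_def)
qed

end

section \<open>Independence of strip conditions in orthogonal directions\<close>

lemma orthogonal_projection_span_singleton:
  assumes "w \<noteq> 0"
  shows "orthogonal_projection (span {w}) v = (v \<bullet> w / (w \<bullet> w)) *\<^sub>R w"
  unfolding orthogonal_projection_def
proof (rule the_equality)
  show "(v \<bullet> w / (w \<bullet> w)) *\<^sub>R w \<in> span {w} \<and>
    (\<forall>z\<in>span {w}. orthogonal (v - (v \<bullet> w / (w \<bullet> w)) *\<^sub>R w) z)"
    using assms by (auto simp: span_singleton orthogonal_def inner_diff_left)
  fix u assume "u \<in> span {w} \<and> (\<forall>z\<in>span {w}. orthogonal (v - u) z)"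
  then have "orthogonal (v - u) w" "u \<in> span {w}"
    by (auto simp: span_base)
  moreover from this obtain c where c: "u = c *\<^sub>R w"
    by (auto simp: span_singleton)
  ultimately have "v \<bullet> w = c * (w \<bullet> w)" by (simp add: orthogonal_def inner_diff_left)
  with c assms show "u = (v \<bullet> w / (w \<bullet> w)) *\<^sub>R w" by simp
qed

context reflectable_start
begin

lemma measurable_Y_stays:
  assumes U: "open U" "U \<noteq> UNIV" and t: "0 \<le> t"
  shows "{\<omega>\<in>space M. \<forall>s\<in>{0..t}. Y s \<omega> \<in> U} \<in> sets M"
proof -
  have "{\<omega>\<in>space M. \<forall>s\<in>{0..t}. Y s \<omega> \<in> U} = {\<omega>\<in>space M. stays U t (\<lambda>s. Y s \<omega>)}"
    using stays_iff[OF U t Y_cont] by auto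
  also have "\<dots> \<in> sets M"
    using measurable_stays[of "\<lambda>_. t" M Y U] Y_meas by (simp add: pred_def)
  finally show ?thesis .
qed

lemma prob_of_stays:
  assumes U: "open U" "U \<noteq> UNIV" and t: "0 \<le> t"
  shows "prob_of (P x) (\<lambda>\<omega>. \<forall>s\<in>{0..t}. X s \<omega> \<in> U) = prob {\<omega>\<in>space M. \<forall>s\<in>{0..t}. Y s \<omega> \<in> U}"
proof -
  have "prob_of (P x) (\<lambda>\<omega>. \<forall>s\<in>{0..t}. X s \<omega> \<in> U) = prob {\<omega>\<in>space (P x). \<forall>s\<in>{0..t}. Y s \<omega> \<in> U}"
    by (rule prob_of_eq_AE) (use measurable_Y_stays[OF U t] in \<open>auto intro!: AE_goodI simp: Y_eq\<close>)
  then show ?thesis by simp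
qed

text \<open>The projection of a point to the line spanned by \<open>w j\<close> has the same inner
  product with \<open>w j\<close> as the point itself. So each strip condition depends on one
  projected path, and these paths are independent.\<close>

lemma prob_orthogonal_strips:
  assumes indep: "indep_orthogonal_components P X" and J: "finite J"
    and w: "\<And>j. j \<in> J \<Longrightarrow> w j \<noteq> 0"
    and ortho: "\<And>i j. i \<in> J \<Longrightarrow> j \<in> J \<Longrightarrow> i \<noteq> j \<Longrightarrow> w i \<bullet> w j = 0" and t: "0 \<le> t"
  shows "prob {\<omega>\<in>space M. \<forall>j\<in>J. \<forall>s\<in>{0..t}. 0 < Y s \<omega> \<bullet> w j \<and> Y s \<omega> \<bullet> w j < 1} =
    (\<Prod>j\<in>J. prob {\<omega>\<in>space M. \<forall>s\<in>{0..t}. 0 < Y s \<omega> \<bullet> w j \<and> Y s \<omega> \<bullet> w j < 1})"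
proof (cases "J = {}")
  case True
  then show ?thesis using prob_space by simp
next
  case False
  let ?L = "\<lambda>j. span {w j}"
  define U where "U j = {v. 0 < v \<bullet> w j \<and> v \<bullet> w j < 1}" for j
  have U: "open (U j)" "U j \<noteq> UNIV" for j
  proof -
    have "U j = {v. 0 < v \<bullet> w j} \<inter> {v. v \<bullet> w j < 1}" by (auto simp: U_def)
    also have "open \<dots>" by (intro open_Int open_Collect_less continuous_intros)
    finally show "open (U j)" .
    have "0 \<notin> U j" by (simp add: U_def)
    then show "U j \<noteq> UNIV" by blast
  qed
  \<comment> \<open>Independence is indexed by the subspaces themselves, so different
    \<open>j\<close> must give different lines; \<open>inv\<close> below recovers \<open>j\<close>
    from its line.\<close>
  have inj: "inj_on ?L J"
  proof (rule inj_onI, rule ccontr)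
    fix i j assume *: "i \<in> J" "j \<in> J" "span {w i} = span {w j}" "i \<noteq> j"
    then have "w i \<in> span {w j}" by (metis insertI1 span_base)
    then obtain c where "w i = c *\<^sub>R w j" by (auto simp: span_singleton)
    with ortho[OF *(1,2,4)] w * show False by auto
  qed
  define inv where "inv S = the_inv_into J ?L S" for S
  have inv: "inv (?L j) = j" if "j \<in> J" for j
    unfolding inv_def by (rule the_inv_into_f_f[OF inj that])
  let ?Z = "\<lambda>S. trajectory (\<lambda>t \<omega>. orthogonal_projection S (X t \<omega>))"
  have ind: "indep_vars (\<lambda>_. path_space) ?Z (?L ` J)"
  proof -
    have "(\<forall>S\<in>?L ` J. subspace S) \<and> pairwise (\<lambda>S S'. \<forall>u\<in>S. \<forall>v\<in>S'. orthogonal u v) (?L ` J)"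
    proof
      show "\<forall>S\<in>?L ` J. subspace S" by (simp add: subspace_span)
      show "pairwise (\<lambda>S S'. \<forall>u\<in>S. \<forall>v\<in>S'. orthogonal u v) (?L ` J)"
        using ortho by (auto simp: pairwise_def orthogonal_def span_singleton)
    qed
    then show ?thesis using indep unfolding indep_orthogonal_components_def by blast
  qed
  \<comment> \<open>Using \<open>stays\<close> makes this a set of the product \<sigma>-algebra; on
    continuous paths it means staying in the strip.\<close>
  define A where "A S = {y \<in> space path_space. stays (U (inv S)) t y}" for S
  have A: "A S \<in> sets path_space" for S
  proof -
    have "(\<lambda>y. y r) \<in> borel_measurable (path_space :: (real \<Rightarrow> real ^ 'k) measure)" if "0 \<le> r" for r
      unfolding path_space_def by (rule measurable_component_singleton) (use that in auto)
    then show ?thesis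
      using measurable_stays[of "\<lambda>_. t" path_space "\<lambda>r y. y r" "U (inv S)"] by (simp add: A_def pred_def)
  qed
  have Z: "?Z S -` A S \<inter> space (P x) \<in> events" if "S \<in> ?L ` J" for S
  proof -
    have "?Z S \<in> P x \<rightarrow>\<^sub>M path_space" using ind that unfolding indep_vars_def by blast
    from measurable_sets[OF this A] show ?thesis .
  qed
  have F: "{\<omega>\<in>space M. \<forall>s\<in>{0..t}. Y s \<omega> \<in> U j} \<in> events" for j
    using measurable_Y_stays[OF U t] by simp
  have mem: "\<omega> \<in> ?Z (?L j) -` A (?L j) \<inter> space (P x) \<longleftrightarrow> (\<forall>s\<in>{0..t}. Y s \<omega> \<in> U j)"
    if "j \<in> J" "\<omega> \<in> space M" "\<omega> \<notin> N0" for j \<omega>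
  proof -
    let ?p = "orthogonal_projection (?L j)"
    have p: "?p v \<bullet> w j = v \<bullet> w j" for v
      using w[OF that(1)] by (simp add: orthogonal_projection_span_singleton)
    have "continuous_on {0..} (\<lambda>s. ?p (Y s \<omega>))"
      unfolding orthogonal_projection_span_singleton[OF w[OF that(1)]]
      by (intro continuous_intros Y_cont that) (use w that in simp)
    note * = stays_iff[OF U t this, of j]
    have "\<omega> \<in> ?Z (?L j) -` A (?L j) \<inter> space (P x) \<longleftrightarrow> stays (U j) t (?Z (?L j) \<omega>)"
      using that by (simp add: A_def inv trajectory_def path_space_def space_PiM)
    also have "\<dots> \<longleftrightarrow> stays (U j) t (\<lambda>s. ?p (Y s \<omega>))"
      using that by (intro stays_cong) (simp add: trajectory_def Y_eq)
    also have "\<dots> \<longleftrightarrow> (\<forall>s\<in>{0..t}. Y s \<omega> \<in> U j)"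
      unfolding * by (simp add: U_def p)
    finally show ?thesis .
  qed
  have "prob {\<omega>\<in>space M. \<forall>j\<in>J. \<forall>s\<in>{0..t}. Y s \<omega> \<in> U j} = prob (\<Inter>S\<in>?L ` J. ?Z S -` A S \<inter> space (P x))"
  proof (rule finite_measure_eq_AE)
    show "AE \<omega> in P x. (\<omega> \<in> {\<omega>\<in>space M. \<forall>j\<in>J. \<forall>s\<in>{0..t}. Y s \<omega> \<in> U j}) =
       (\<omega> \<in> (\<Inter>S\<in>?L ` J. ?Z S -` A S \<inter> space (P x)))"
    proof (rule AE_goodI)
      fix \<omega> assume "\<omega> \<in> space M" "\<omega> \<notin> N0"
      with mem[of _ \<omega>] show "(\<omega> \<in> {\<omega>\<in>space M. \<forall>j\<in>J. \<forall>s\<in>{0..t}. Y s \<omega> \<in> U j}) =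
       (\<omega> \<in> (\<Inter>S\<in>?L ` J. ?Z S -` A S \<inter> space (P x)))"
        by (simp only: mem_Collect_eq INT_iff ball_simps) blast
    qed
    have "{\<omega>\<in>space M. \<forall>j\<in>J. \<forall>s\<in>{0..t}. Y s \<omega> \<in> U j} = (\<Inter>j\<in>J. {\<omega>\<in>space M. \<forall>s\<in>{0..t}. Y s \<omega> \<in> U j})"
      using False by auto
    then show "{\<omega>\<in>space M. \<forall>j\<in>J. \<forall>s\<in>{0..t}. Y s \<omega> \<in> U j} \<in> events"
      using F J False by (simp only:) (rule sets.finite_INT, auto)
    show "(\<Inter>S\<in>?L ` J. ?Z S -` A S \<inter> space (P x)) \<in> events"
      using Z J False by (intro sets.finite_INT) auto
  qed
  also have "\<dots> = (\<Prod>S\<in>?L ` J. prob (?Z S -` A S \<inter> space (P x)))"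
    using False J A by (intro indep_varsD[OF ind]) auto
  also have "\<dots> = (\<Prod>j\<in>J. prob (?Z (?L j) -` A (?L j) \<inter> space (P x)))"
    using inj by (subst prod.reindex) auto
  also have "\<dots> = (\<Prod>j\<in>J. prob {\<omega>\<in>space M. \<forall>s\<in>{0..t}. Y s \<omega> \<in> U j})"
  proof (rule prod.cong[OF refl])
    fix j assume j: "j \<in> J"
    show "prob (?Z (?L j) -` A (?L j) \<inter> space (P x)) = prob {\<omega>\<in>space M. \<forall>s\<in>{0..t}. Y s \<omega> \<in> U j}"
    proof (rule finite_measure_eq_AE)
      show "AE \<omega> in P x. (\<omega> \<in> ?Z (?L j) -` A (?L j) \<inter> space (P x)) = (\<omega> \<in> {\<omega>\<in>space M. \<forall>s\<in>{0..t}. Y s \<omega> \<in> U j})"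
      proof (rule AE_goodI)
        fix \<omega> assume \<omega>: "\<omega> \<in> space M" "\<omega> \<notin> N0"
        show "(\<omega> \<in> ?Z (?L j) -` A (?L j) \<inter> space (P x)) = (\<omega> \<in> {\<omega>\<in>space M. \<forall>s\<in>{0..t}. Y s \<omega> \<in> U j})"
          unfolding mem[OF j \<omega>] using \<omega> by simp
      qed
    qed (use Z j F in blast)+
  qed
  finally show ?thesis by (simp add: U_def)
qed

end

section \<open>The alcove and its walls\<close>

definition idx :: "nat \<Rightarrow> 'k::{finite,linorder}" where
  "idx i = sorted_list_of_set UNIV ! (i - 1)"

lemma coord_idx: "coord v i = v $ idx i"
  by (simp add: coord_def idx_def)

lemma coord_axis: "coord v i = v \<bullet> axis (idx i) 1"
  by (simp add: coord_idx inner_axis)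

lemma continuous_coord [continuous_intros]: "continuous_on S (\<lambda>v. coord v i)"
  unfolding coord_axis by (intro continuous_intros)

lemma idx_eq_iff:
  assumes "i \<in> {1..CARD('k)}" "j \<in> {1..CARD('k)}"
  shows "(idx i :: 'k::{finite,linorder}) = idx j \<longleftrightarrow> i = j"
proof -
  have "length (sorted_list_of_set (UNIV :: 'k set)) = CARD('k)"
    by (rule sorted_list_of_set.length_sorted_key_list_of_set)
  then show ?thesis using assms by (auto simp: idx_def nth_eq_iff_index_eq)
qed

text \<open>For the parameters \<open>(1, 0)\<close>, \<open>(- 1, 0)\<close>,
  \<open>(- 1, 1)\<close> this is the reflection in the hyperplane
  \<open>x_a = \<epsilon> * x_(a+1) + c\<close>, so one formula serves all walls.\<close>

definition affine_reflection :: "nat \<Rightarrow> real \<Rightarrow> real \<Rightarrow> real ^ 'k::{finite,linorder} \<Rightarrow> (real, 'k) vec" where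
  "affine_reflection a \<epsilon> c v = (\<chi> j. if j = idx a then \<epsilon> * coord v (Suc a) + c
     else if j = idx (Suc a) then \<epsilon> * coord v a + c else v $ j)"

lemma coord_affine_reflection:
  fixes v :: "real ^ 'k::{finite,linorder}"
  assumes "1 \<le> a" "Suc a \<le> CARD('k)" "1 \<le> j" "j \<le> CARD('k)"
  shows "coord (affine_reflection a \<epsilon> c v) j = (if j = a then \<epsilon> * coord v (Suc a) + c
     else if j = Suc a then \<epsilon> * coord v a + c else coord v j)"
  using assms idx_eq_iff[of j a, where 'k = 'k] idx_eq_iff[of j "Suc a", where 'k = 'k]
  by (auto simp: affine_reflection_def coord_idx)

lemma continuous_affine_reflection: "continuous_on S (affine_reflection a \<epsilon> c)"
  unfolding affine_reflection_def[abs_def]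
proof (rule continuous_on_vec_lambda)
  fix j
  show "continuous_on S (\<lambda>v. if j = idx a then \<epsilon> * coord v (Suc a) + c
     else if j = idx (Suc a) then \<epsilon> * coord v a + c else v $ j)"
    by (cases "j = idx a"; cases "j = idx (Suc a)") (auto intro!: continuous_intros)
qed

text \<open>Both parity conditions hold because two coordinates are treated alike: zero or two signs
  change, and the translation has coordinate sum \<open>2 * c\<close>.\<close>

lemma affine_reflection_in_affine_weyl_D:
  assumes a: "1 \<le> a" "Suc a \<le> CARD('k)" and \<epsilon>c: "(\<epsilon>, c) \<in> {(1, 0), (- 1, 0), (- 1, 1)}"
  shows "(affine_reflection a \<epsilon> c :: real ^ 'k::{finite,linorder} \<Rightarrow> (real, 'k) vec) \<in> affine_weyl_D"
proof -
  let ?p = "idx a :: 'k" and ?q = "idx (Suc a) :: 'k"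
  have ne: "?p \<noteq> ?q" using a by (subst idx_eq_iff) auto
  define w where "w = (\<lambda>v :: (real, 'k) vec. \<chi> i. (if i \<in> {?p, ?q} then \<epsilon> else 1) * v $ Transposition.transpose ?p ?q i)"
  define d :: "(real, 'k) vec" where "d = (\<chi> i. if i \<in> {?p, ?q} then c else 0)"
  have "{i. (if i \<in> {?p, ?q} then \<epsilon> else 1) = - 1} = (if \<epsilon> = - 1 then {?p, ?q} else {})"
    by auto
  then have "even (card {i. (if i \<in> {?p, ?q} then \<epsilon> else 1) = - 1})" using ne by simp
  moreover have "Transposition.transpose ?p ?q permutes UNIV" by (rule permutes_swap_id) auto
  ultimately have "w \<in> even_signed_perms"
    unfolding even_signed_perms_def w_def using \<epsilon>c
    by (intro CollectI exI[of _ "Transposition.transpose ?p ?q"] exI[of _ "\<lambda>i. if i \<in> {?p, ?q} then \<epsilon> else 1"]) auto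
  moreover have "d \<in> even_lattice"
  proof -
    have "(\<Sum>i\<in>UNIV. d $ i) = (\<Sum>i\<in>{?p, ?q}. c)"
      unfolding d_def by (simp only: vec_lambda_beta, subst sum.inter_restrict[symmetric]) auto
    also have "\<dots> = 2 * c" using ne by simp
    finally show ?thesis using \<epsilon>c unfolding even_lattice_def d_def
      by (auto intro: exI[of _ 0] exI[of _ 1])
  qed
  moreover have "affine_reflection a \<epsilon> c = (\<lambda>v. w v + d)"
    using ne by (auto simp: fun_eq_iff vec_eq_iff affine_reflection_def w_def d_def coord_idx Transposition.transpose_def)
  ultimately show ?thesis unfolding affine_weyl_D_def by blast
qed

text \<open>The wall \<open>i \<in> {0..k}\<close> is the hyperplane \<open>x\<^sub>1 + x\<^sub>2 = 1\<close> for \<open>i = 0\<close>,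
  \<open>x\<^sub>i = x\<^sub>i\<^sub>+\<^sub>1\<close> for \<open>0 < i < k\<close>, and \<open>x\<^sub>k\<^sub>-\<^sub>1 + x\<^sub>k = 0\<close> for \<open>i = k\<close>; it has the
  equation \<open>x\<^sub>a = \<epsilon> x\<^sub>a\<^sub>+\<^sub>1 + c\<close>.\<close>

definition wall_index :: "nat \<Rightarrow> nat \<Rightarrow> nat" where
  "wall_index k i = (if i = 0 then 1 else if i = k then k - 1 else i)"

definition wall_sign :: "nat \<Rightarrow> nat \<Rightarrow> real" where
  "wall_sign k i = (if i = 0 \<or> i = k then - 1 else 1)"

definition wall_const :: "nat \<Rightarrow> real" where
  "wall_const i = (if i = 0 then 1 else 0)"

text \<open>The leading sign makes the form positive on the side of the alcove: wall 0 bounds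
  \<open>x_1 + x_2\<close> from above, while the other walls are lower bounds.\<close>

definition wall_form :: "nat \<Rightarrow> real ^ 'k::{finite,linorder} \<Rightarrow> real" where
  "wall_form i v = (if i = 0 then - 1 else 1) *
     (coord v (wall_index CARD('k) i) - wall_sign CARD('k) i * coord v (Suc (wall_index CARD('k) i)) - wall_const i)"

definition wall_reflection :: "nat \<Rightarrow> real ^ 'k::{finite,linorder} \<Rightarrow> (real, 'k) vec" where
  "wall_reflection i = affine_reflection (wall_index CARD('k) i) (wall_sign CARD('k) i) (wall_const i)"

lemma wall_reflection_in_affine_weyl_D:
  assumes "3 \<le> CARD('k)" "i \<le> CARD('k)"
  shows "(wall_reflection i :: real ^ 'k::{finite,linorder} \<Rightarrow> (real, 'k) vec) \<in> affine_weyl_D"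
  unfolding wall_reflection_def
  by (rule affine_reflection_in_affine_weyl_D) (use assms in \<open>auto simp: wall_index_def wall_sign_def wall_const_def\<close>)

lemma wall_reflection_fixed:
  fixes v :: "real ^ 'k::{finite,linorder}"
  assumes "wall_form i v = 0"
  shows "wall_reflection i v = v"
proof -
  let ?a = "wall_index CARD('k) i" and ?\<epsilon> = "wall_sign CARD('k) i" and ?c = "wall_const i"
  have eq: "coord v ?a = ?\<epsilon> * coord v (Suc ?a) + ?c"
    using assms by (auto simp: wall_form_def split: if_splits)
  \<comment> \<open>These identities make the equation of the wall symmetric in its two
    coordinates.\<close>
  moreover have "?\<epsilon> * ?\<epsilon> = 1" "?\<epsilon> * ?c + ?c = 0"
    by (auto simp: wall_sign_def wall_const_def)
  ultimately have "?\<epsilon> * coord v ?a + ?c = coord v (Suc ?a)"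
    by (simp add: distrib_left flip: mult.assoc)
  with eq show ?thesis
    unfolding wall_reflection_def affine_reflection_def vec_eq_iff coord_idx by simp
qed

lemma continuous_wall_form: "continuous_on S (wall_form i)"
  unfolding wall_form_def[abs_def] by (intro continuous_intros)

lemma open_wall: "open {v. 0 < wall_form i v}"
  by (intro open_Collect_less continuous_wall_form continuous_on_const)

lemma wall_halfspace_neq_UNIV:
  assumes k: "3 \<le> CARD('k)" and i: "i \<le> CARD('k)"
  shows "{v :: real ^ 'k::{finite,linorder}. 0 < wall_form i v} \<noteq> UNIV"
proof -
  \<comment> \<open>The origin lies on every wall except wall 0; for that one, the point with all
    coordinates 1 has \<open>x_1 + x_2 = 2\<close>.\<close>
  let ?v = "(\<chi> j. if i = 0 then 1 else 0) :: (real, 'k) vec"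
  have "\<not> 0 < wall_form i ?v"
    by (simp add: wall_form_def wall_sign_def wall_const_def coord_idx)
  then show ?thesis by blast
qed

lemma alcove_D_eq_walls:
  assumes k: "3 \<le> CARD('k)"
  shows "(alcove_D :: (real ^ 'k::{finite,linorder}) set) = {v. \<forall>i\<in>{0..CARD('k)}. 0 < wall_form i v}"
proof -
  let ?k = "CARD('k)"
  have "v \<in> alcove_D \<longleftrightarrow> (\<forall>i\<in>{0..?k}. 0 < wall_form i v)" for v :: "(real, 'k) vec"
  proof
    assume v: "v \<in> alcove_D"
    show "\<forall>i\<in>{0..?k}. 0 < wall_form i v"
    proof
      fix i assume "i \<in> {0..?k}"
      then consider "i = 0" | "1 \<le> i" "i + 1 \<le> ?k - 1" | "i = ?k - 1" | "i = ?k" by force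
      then show "0 < wall_form i v"
        using v k by cases (auto simp: alcove_D_def wall_form_def wall_index_def wall_sign_def wall_const_def numeral_2_eq_2)
    qed
  next
    assume w: "\<forall>i\<in>{0..?k}. 0 < wall_form i v"
    have "coord v i > coord v (i + 1)" if "1 \<le> i" "i + 1 \<le> ?k - 1" for i
    proof -
      have "i < ?k" using that by linarith
      then show ?thesis using w[rule_format, of i] that by (auto simp: wall_form_def wall_index_def wall_sign_def wall_const_def)
    qed
    moreover have "0 < wall_form (?k - 1) v" "0 < wall_form ?k v" "0 < wall_form 0 v" using w by auto
    moreover have "?k - 1 \<noteq> ?k" using k by simp
    ultimately show "v \<in> alcove_D"
      using k by (auto simp: alcove_D_def wall_form_def wall_index_def wall_sign_def wall_const_def numeral_2_eq_2)
  qed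
  then show ?thesis by blast
qed

section \<open>Regions attached to pair partitions\<close>

definition block_region :: "nat set \<Rightarrow> (real ^ 'k::{finite,linorder}) set" where
  "block_region B = {v. Max B \<le> CARD('k) \<longrightarrow>
     0 < coord v (Min B) - coord v (Max B) \<and> coord v (Min B) - coord v (Max B) < 1 \<and>
     0 < coord v (Min B) + coord v (Max B) \<and> coord v (Min B) + coord v (Max B) < 1}"

definition region :: "nat set set \<Rightarrow> (real ^ 'k::{finite,linorder}) set" where
  "region \<pi> = (\<Inter>B\<in>\<pi>. block_region B)"

lemma open_block_region: "open (block_region B :: (real ^ 'k::{finite,linorder}) set)"
proof (cases "Max B \<le> CARD('k)")
  case True
  then have "(block_region B :: ((real, 'k) vec) set) =
    {v. 0 < coord v (Min B) - coord v (Max B)} \<inter> {v. coord v (Min B) - coord v (Max B) < 1} \<inter>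
    {v. 0 < coord v (Min B) + coord v (Max B)} \<inter> {v. coord v (Min B) + coord v (Max B) < 1}"
    by (auto simp: block_region_def)
  also have "open \<dots>" by (intro open_Int open_Collect_less continuous_intros)
  finally show ?thesis .
qed (simp add: block_region_def)

lemma open_region: "finite \<pi> \<Longrightarrow> open (region \<pi>)"
  unfolding region_def by (intro open_INT ballI open_block_region)

text \<open>In the alcove \<open>\<bar>x_j\<bar> < x_i\<close> for \<open>i < j\<close>, which gives
  positivity of both forms, and \<open>x_i + \<bar>x_j\<bar> \<le> x_1 + x_2 < 1\<close> gives the
  upper bounds. The coordinates decrease only up to index \<open>k - 1\<close>; the last one enters
  through its absolute value.\<close>

lemma alcove_D_subset_block_region:
  assumes B: "card B = 2" "B \<subseteq> {1..n}" and k: "3 \<le> CARD('k)"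
  shows "(alcove_D :: (real ^ 'k::{finite,linorder}) set) \<subseteq> block_region B"
proof
  fix v :: "(real, 'k) vec" assume v: "v \<in> alcove_D"
  let ?k = "CARD('k)"
  obtain i j where ij: "B = {i, j}" "i < j" "Min B = i" "Max B = j" using B(1) by (rule pair_block)
  have dec: "coord v b \<le> coord v a \<and> (a < b \<longrightarrow> coord v b < coord v a)" if "1 \<le> a" "a \<le> b" "b \<le> ?k - 1" for a b
    using that(2,3)
  proof (induction b rule: dec_induct)
    case (step b)
    then have "coord v b > coord v (b + 1)" using v that by (auto simp: alcove_D_def)
    with step show ?case by auto
  qed simp
  have last: "\<bar>coord v ?k\<bar> < coord v (?k - 1)" and top: "coord v 1 + coord v 2 < 1"
    using v by (auto simp: alcove_D_def)
  have abs: "\<bar>coord v b\<bar> \<le> coord v a" if "1 \<le> a" "a \<le> b" "b \<le> ?k" "a < ?k" for a b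
  proof (cases "b = ?k")
    case True
    moreover have "a \<le> ?k - 1" using that True by linarith
    ultimately show ?thesis using dec[of a "?k - 1"] last that by auto
  next
    case False
    moreover from this have "b \<le> ?k - 1" using that by linarith
    ultimately show ?thesis using dec[of a b] dec[of b "?k - 1"] last that by auto
  qed
  have less: "\<bar>coord v b\<bar> < coord v a" if "1 \<le> a" "a < b" "b \<le> ?k" for a b
  proof (cases "b = ?k")
    case True
    moreover have "a \<le> ?k - 1" using that True by linarith
    ultimately show ?thesis using dec[of a "?k - 1"] last that by auto
  next
    case False
    moreover from this have "b \<le> ?k - 1" using that by linarith
    ultimately show ?thesis using dec[of a b] dec[of b "?k - 1"] last that by auto
  qed
  show "v \<in> block_region B"
  proof (cases "j \<le> ?k")
    case True
    have i: "1 \<le> i" using ij B by auto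
    then have "\<bar>coord v j\<bar> < coord v i" "coord v i \<le> coord v 1" "\<bar>coord v j\<bar> \<le> coord v 2"
      using less[of i j] abs[of 1 i] abs[of 2 j] True ij k by auto
    then show ?thesis using top ij by (auto simp: block_region_def)
  qed (simp add: block_region_def ij)
qed

lemma block_region_adj_swap:
  fixes v :: "real ^ 'k::{finite,linorder}"
  assumes k: "3 \<le> CARD('k)" and i: "i \<le> CARD('k)" and a: "a = wall_index CARD('k) i"
    and B: "card B = 2" "B \<subseteq> {1..Suc CARD('k)}" "B \<noteq> {a, Suc a}"
  shows "v \<in> block_region (adj_swap a ` B) \<longleftrightarrow> wall_reflection i v \<in> block_region B"
proof -
  obtain p q where pq: "B = {p, q}" "p < q" "Min B = p" "Max B = q" using B(1) by (rule pair_block)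
  have pq1: "1 \<le> p" "q \<le> Suc CARD('k)" "(p, q) \<noteq> (a, Suc a)" using B pq by auto
  have a1: "1 \<le> a" "Suc a \<le> CARD('k)" using k i a by (auto simp: wall_index_def)
  define u where "u = wall_reflection i v"
  have u: "coord u j = (if j = a then wall_sign CARD('k) i * coord v (Suc a) + wall_const i
     else if j = Suc a then wall_sign CARD('k) i * coord v a + wall_const i else coord v j)"
    if "1 \<le> j" "j \<le> CARD('k)" for j
    unfolding u_def wall_reflection_def a[symmetric] using a1 that by (rule coord_affine_reflection)
  note iff = u_def[symmetric] block_region_def mem_Collect_eq Min_Max_transpose[OF B(1,3)] pq(3,4)
  consider "q = Suc CARD('k)" | "q \<le> CARD('k)" "p \<in> {a, Suc a}" "Suc a < q" | "q \<le> CARD('k)" "q \<in> {a, Suc a}" "p < a"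
    | "q \<le> CARD('k)" "p \<notin> {a, Suc a}" "q \<notin> {a, Suc a}"
    using pq1 pq(2) by fastforce
  then show ?thesis
  proof cases
    case 1
    then show ?thesis using a1 unfolding iff by (simp add: Transposition.transpose_def)
  next
    \<comment> \<open>Wall \<open>k\<close> has \<open>Suc a = k\<close>, which leaves no room for
      \<open>q\<close>. At wall 0 the smaller index receives \<open>1 - x\<close>, which exchanges
      the two strips.\<close>
    case 2
    then have "i \<noteq> CARD('k)" using k by (auto simp: a wall_index_def)
    then show ?thesis using 2 pq1(1) a1 unfolding iff
      by (cases "p = a"; cases "i = 0") (auto simp: u Transposition.transpose_def wall_sign_def wall_const_def)
  next
    \<comment> \<open>Wall 0 has \<open>a = 1\<close>, which leaves no room for \<open>p\<close>. At
      wall \<open>k\<close> the larger index is negated, which exchanges sum and difference.\<close>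
    case 3
    moreover have "i = 0 \<Longrightarrow> a = 1" by (simp add: a wall_index_def)
    ultimately have "i \<noteq> 0" using pq1(1) by linarith
    then show ?thesis using 3 pq1(1) a1 unfolding iff
      by (cases "q = a"; cases "i = CARD('k)") (auto simp: u Transposition.transpose_def wall_sign_def wall_const_def)
  next
    case 4
    then show ?thesis using pq1(1) pq(2) unfolding iff by (auto simp: u Transposition.transpose_def)
  qed
qed

lemma region_swap_partition:
  fixes v :: "real ^ 'k::{finite,linorder}"
  assumes k: "3 \<le> CARD('k)" and i: "i \<le> CARD('k)" and a: "a = wall_index CARD('k) i"
    and \<pi>: "\<pi> \<in> pair_partitions {1..n}" "n \<le> Suc CARD('k)" "{a, Suc a} \<notin> \<pi>"
  shows "v \<in> region (swap_partition a \<pi>) \<longleftrightarrow> wall_reflection i v \<in> region \<pi>"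
proof -
  have "v \<in> block_region (adj_swap a ` B) \<longleftrightarrow> wall_reflection i v \<in> block_region B" if "B \<in> \<pi>" for B
  proof (rule block_region_adj_swap[OF k i a])
    have "B \<subseteq> \<Union>\<pi>" using that by blast
    then show "card B = 2" "B \<subseteq> {1..Suc CARD('k)}" "B \<noteq> {a, Suc a}"
      using that \<pi> by (auto simp: pair_partitions_iff partition_on_def)
  qed
  then show ?thesis by (auto simp: region_def swap_partition_def)
qed

text \<open>On the wall, the sum or the difference of the two coordinates equals 0 or 1, an excluded
  endpoint of the strip.\<close>

lemma wall_disjoint_region:
  fixes v :: "real ^ 'k::{finite,linorder}"
  assumes k: "3 \<le> CARD('k)" and i: "i \<le> CARD('k)" and a: "a = wall_index CARD('k) i"
    and \<pi>: "{a, Suc a} \<in> \<pi>" and v: "wall_form i v = 0"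
  shows "v \<notin> region \<pi>"
proof -
  have "Suc a \<le> CARD('k)" using k i a by (auto simp: wall_index_def)
  then have "v \<notin> block_region {a, Suc a}"
    using v by (auto simp: block_region_def wall_form_def a wall_sign_def wall_const_def split: if_splits)
  then show ?thesis using \<pi> by (auto simp: region_def)
qed

text \<open>The encoding by \<open>stays\<close> requires a proper subset. Not every block contains
  \<open>Suc k\<close>, since then 1, 2 and \<open>Suc k\<close> would share a block; a block
  without it excludes the origin.\<close>

lemma region_neq_UNIV:
  assumes k: "3 \<le> CARD('k)" and \<pi>: "\<pi> \<in> pair_partitions {1..n}" "CARD('k) \<le> n" "n \<le> Suc CARD('k)"
  shows "(region \<pi> :: (real ^ 'k::{finite,linorder}) set) \<noteq> UNIV"
proof -
  have part: "\<Union>\<pi> = {1..n}" "disjoint \<pi>" "\<And>B. B \<in> \<pi> \<Longrightarrow> card B = 2"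
    using \<pi>(1) by (simp_all add: pair_partitions_iff partition_on_def)
  have "1 \<in> \<Union>\<pi>" "2 \<in> \<Union>\<pi>" unfolding part using k \<pi> by auto
  then obtain B1 B2 where B: "B1 \<in> \<pi>" "1 \<in> B1" "B2 \<in> \<pi>" "2 \<in> B2" by blast
  have "\<exists>B\<in>\<pi>. Suc CARD('k) \<notin> B"
  proof (rule ccontr)
    assume "\<not> ?thesis"
    then have top: "Suc CARD('k) \<in> B1" "Suc CARD('k) \<in> B2" using B by auto
    then have "B1 = B2" using disjointD[OF part(2) B(1,3)] by auto
    then have "{1, 2, Suc CARD('k)} \<subseteq> B1" using B top by auto
    then have "card {1, 2, Suc CARD('k)} \<le> card B1"
      using part(3)[OF B(1)] by (intro card_mono) (auto intro: card_ge_0_finite)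
    then show False using part(3)[OF B(1)] k by simp
  qed
  then obtain B where B: "B \<in> \<pi>" "Suc CARD('k) \<notin> B" by blast
  obtain p q where pq: "B = {p, q}" "p < q" "Min B = p" "Max B = q" using part(3)[OF B(1)] by (rule pair_block)
  have "q \<in> \<Union>\<pi>" using B pq by auto
  then have "q \<le> CARD('k)" unfolding part using B pq \<pi>(3) by auto
  then have "(0 :: (real, 'k) vec) \<notin> block_region B" using pq by (simp add: block_region_def coord_idx)
  then have "(0 :: (real, 'k) vec) \<notin> region \<pi>" using B by (auto simp: region_def)
  then show ?thesis by blast
qed

section \<open>The exit probability\<close>

text \<open>A block \<open>{i < j}\<close> contributes the vectors \<open>e_i + e_j\<close> and
  \<open>e_i - e_j\<close>. They are orthogonal to each other because \<open>1 - 1 = 0\<close>, and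
  to those of other blocks because blocks are disjoint. Blocks containing \<open>k + 1\<close>
  contribute no vector and the factor 1.\<close>

lemma prob_of_region:
  fixes x :: "real ^ 'k::{finite,linorder}"
  assumes R: "reflectable_start W M P X x N0" and indep: "indep_orthogonal_components P X" and t: "0 \<le> t"
    and k: "3 \<le> CARD('k)" and \<pi>: "\<pi> \<in> pair_partitions {1..n}" and n: "CARD('k) \<le> n" "n \<le> Suc CARD('k)"
  shows "prob_of (P x) (\<lambda>\<omega>. \<forall>s\<in>{0..t}. X s \<omega> \<in> region \<pi>) =
    (\<Prod>B\<in>\<pi>. if Max B \<le> CARD('k) then p_breve (P x) X t (Min B) (Max B) else 1)"
proof -
  interpret reflectable_start W M P X x N0 by (rule R)
  have part: "\<Union>\<pi> = {1..n}" "disjoint \<pi>" and card2: "\<And>B. B \<in> \<pi> \<Longrightarrow> card B = 2"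
    using \<pi> by (simp_all add: pair_partitions_iff partition_on_def)
  have fin: "finite \<pi>" using \<pi> by (auto simp: pair_partitions_iff intro: finite_elements[rotated])
  define \<pi>' where "\<pi>' = {B \<in> \<pi>. Max B \<le> CARD('k)}"
  define J where "J = \<pi>' \<times> {1, - 1 :: real}"
  define w :: "nat set \<times> real \<Rightarrow> (real, 'k) vec" where
    "w = (\<lambda>(B, b). axis (idx (Min B)) 1 + b *\<^sub>R axis (idx (Max B)) 1)"
  have w: "v \<bullet> w (B, b) = coord v (Min B) + b * coord v (Max B)" for v B b
    by (simp add: w_def inner_add_right coord_axis)
  have B: "Min B \<in> B" "Max B \<in> B" "Min B < Max B" "Min B \<in> {1..CARD('k)}" "Max B \<in> {1..CARD('k)}" if "B \<in> \<pi>'" for B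
  proof -
    have B\<pi>: "B \<in> \<pi>" "Max B \<le> CARD('k)" using that by (auto simp: \<pi>'_def)
    obtain p q where pq: "B = {p, q}" "p < q" "Min B = p" "Max B = q" using pair_block[OF card2[OF B\<pi>(1)]] by metis
    have "B \<subseteq> {1..n}" using B\<pi> part by blast
    with pq B\<pi> show "Min B \<in> B" "Max B \<in> B" "Min B < Max B" "Min B \<in> {1..CARD('k)}" "Max B \<in> {1..CARD('k)}"
      by auto
  qed
  have ax: "axis (idx i) (1 :: real) \<bullet> axis (idx j :: 'k) 1 = (if i = j then 1 else 0)"
    if "i \<in> {1..CARD('k)}" "j \<in> {1..CARD('k)}" for i j
    using idx_eq_iff[OF that] by (simp add: inner_axis_axis)
  have ww: "w (B, b) \<bullet> w (B', b') = (if B = B' then 1 + b * b' else 0)" if "B \<in> \<pi>'" "B' \<in> \<pi>'" for B B' b b'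
  proof (cases "B = B'")
    case True
    then show ?thesis using B[OF that(1)] by (simp add: w_def inner_add_left inner_add_right ax)
  next
    case False
    then have "B \<inter> B' = {}" using part(2) that by (auto simp: \<pi>'_def disjoint_def)
    then have "Min B \<noteq> Min B'" "Min B \<noteq> Max B'" "Max B \<noteq> Min B'" "Max B \<noteq> Max B'"
      using B[OF that(1)] B[OF that(2)] by (metis disjoint_iff)+
    then show ?thesis using False B[OF that(1)] B[OF that(2)]
      by (simp add: w_def inner_add_left inner_add_right ax)
  qed
  define U where "U j = {v. 0 < v \<bullet> w j \<and> v \<bullet> w j < 1}" for j
  have U: "open (U j)" "U j \<noteq> UNIV" for j
  proof -
    have "U j = {v. 0 < v \<bullet> w j} \<inter> {v. v \<bullet> w j < 1}" by (auto simp: U_def)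
    also have "open \<dots>" by (intro open_Int open_Collect_less continuous_intros)
    finally show "open (U j)" .
    have "0 \<notin> U j" by (simp add: U_def)
    then show "U j \<noteq> UNIV" by blast
  qed
  have region: "v \<in> region \<pi> \<longleftrightarrow> (\<forall>j\<in>J. v \<in> U j)" for v
    by (auto simp: region_def block_region_def J_def U_def w \<pi>'_def)
  let ?F = "\<lambda>j. prob {\<omega>\<in>space M. \<forall>s\<in>{0..t}. Y s \<omega> \<in> U j}"
  have breve: "p_breve (P x) X t (Min B) (Max B) = ?F (B, 1) * ?F (B, - 1)" if "B \<in> \<pi>'" for B
  proof -
    have "prob_of (P x) (\<lambda>\<omega>. \<forall>s\<in>{0..t}. 1 > coord (X s \<omega>) (Min B) - coord (X s \<omega>) (Max B) \<and>
      coord (X s \<omega>) (Min B) - coord (X s \<omega>) (Max B) > 0) = ?F (B, - 1)"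
      using prob_of_stays[OF U t, of "(B, - 1)"] by (simp add: U_def w conj_commute)
    moreover have "prob_of (P x) (\<lambda>\<omega>. \<forall>s\<in>{0..t}. 1 > coord (X s \<omega>) (Min B) + coord (X s \<omega>) (Max B) \<and>
      coord (X s \<omega>) (Min B) + coord (X s \<omega>) (Max B) > 0) = ?F (B, 1)"
      using prob_of_stays[OF U t, of "(B, 1)"] by (simp add: U_def w conj_commute)
    ultimately show ?thesis using B(3)[OF that] unfolding p_breve_def Let_def by simp
  qed
  have "prob_of (P x) (\<lambda>\<omega>. \<forall>s\<in>{0..t}. X s \<omega> \<in> region \<pi>) = prob {\<omega>\<in>space M. \<forall>s\<in>{0..t}. Y s \<omega> \<in> region \<pi>}"
    by (rule prob_of_stays[OF open_region[OF fin] region_neq_UNIV[OF k \<pi> n] t])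
  also have "{\<omega>\<in>space M. \<forall>s\<in>{0..t}. Y s \<omega> \<in> region \<pi>} =
      {\<omega>\<in>space M. \<forall>j\<in>J. \<forall>s\<in>{0..t}. 0 < Y s \<omega> \<bullet> w j \<and> Y s \<omega> \<bullet> w j < 1}"
    unfolding region U_def by blast
  also have "prob \<dots> = (\<Prod>j\<in>J. ?F j)"
    unfolding U_def mem_Collect_eq
  proof (rule prob_orthogonal_strips[OF indep _ _ _ t])
    show "finite J" using fin by (simp add: J_def \<pi>'_def)
    show "w j \<noteq> 0" if j: "j \<in> J" for j
    proof
      assume "w j = 0"
      moreover obtain B b where "j = (B, b)" "B \<in> \<pi>'" "b * b = 1" using j by (auto simp: J_def)
      ultimately show False using ww[of B B b b] by simp
    qed
    show "w i \<bullet> w j = 0" if ij: "i \<in> J" "j \<in> J" "i \<noteq> j" for i j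
    proof -
      obtain B b B' b' where "i = (B, b)" "j = (B', b')" by (cases i, cases j)
      with ij ww[of B B' b b'] show ?thesis by (cases "B = B'") (auto simp: J_def)
    qed
  qed
  also have "\<dots> = (\<Prod>B\<in>\<pi>'. \<Prod>b\<in>{1, - 1}. ?F (B, b))"
    unfolding J_def by (simp only: prod.cartesian_product) (simp add: case_prod_beta)
  also have "\<dots> = (\<Prod>B\<in>\<pi>'. p_breve (P x) X t (Min B) (Max B))"
    by (rule prod.cong[OF refl]) (simp add: breve)
  also have "\<dots> = (\<Prod>B\<in>\<pi>. if Max B \<le> CARD('k) then p_breve (P x) X t (Min B) (Max B) else 1)"
    unfolding \<pi>'_def by (rule prod.inter_filter[OF fin])
  finally show ?thesis .
qed

section \<open>Attribution of the exit to a single wall\<close>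

context reflectable_start
begin

lemma stay_time_X:
  assumes "open U" "U \<noteq> UNIV" "\<omega> \<in> space M" "\<omega> \<notin> N0"
  shows "stay_time U (\<lambda>s. X s \<omega>) = exit_time X U \<omega>"
  by (rule stay_time_eq_exit_time) (use assms good in auto)

text \<open>If several walls are hit simultaneously, the exit is attributed to the first of them.\<close>

definition exit_event :: "real \<Rightarrow> (nat \<Rightarrow> (real ^ 'k) set) \<Rightarrow> nat \<Rightarrow> nat \<Rightarrow> 'w set" where
  "exit_event t H m i = {\<omega>\<in>space M. stay_time (\<Inter>j\<in>{0..m}. H j) (\<lambda>s. X s \<omega>) \<le> ennreal t \<and>
     stay_time (H i) (\<lambda>s. X s \<omega>) \<le> stay_time (\<Inter>j\<in>{0..m}. H j) (\<lambda>s. X s \<omega>) \<and>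
     (\<forall>j\<in>{0..<i}. stay_time (\<Inter>j\<in>{0..m}. H j) (\<lambda>s. X s \<omega>) < stay_time (H j) (\<lambda>s. X s \<omega>))}"

text \<open>Whether \<open>T < S\<close> for another stopping time \<open>S\<close> is known at time
  \<open>T\<close>. The condition \<open>S \<le> T\<close> is therefore treated as the negation of
  \<open>T < S\<close>.\<close>

lemma exit_event_pre_sigma:
  "exit_event t H m i \<in>
    sets (filtration.pre_sigma (space M) (right_filtration M X) (\<lambda>\<omega>. stay_time (\<Inter>j\<in>{0..m}. H j) (\<lambda>s. X s \<omega>)))"
proof -
  interpret F: filtration "space M" "right_filtration M X" by (rule filtration_X)
  let ?T = "\<lambda>\<omega>. stay_time (\<Inter>j\<in>{0..m}. H j) (\<lambda>s. X s \<omega>)"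
  have T: "stopping_time (right_filtration M X) ?T" by (rule stopping_time_stay_time)
  have [measurable]: "?T \<in> borel_measurable (F.pre_sigma ?T)"
    by (rule F.measurable_stopping_time_pre_sigma[OF T])
  have [measurable]: "Measurable.pred (F.pre_sigma ?T) (\<lambda>\<omega>. ?T \<omega> < stay_time (H j) (\<lambda>s. X s \<omega>))" for j
    by (rule F.stopping_time_less[OF T stopping_time_stay_time])
  have "Measurable.pred (F.pre_sigma ?T) (\<lambda>\<omega>. ?T \<omega> \<le> ennreal t \<and> \<not> ?T \<omega> < stay_time (H i) (\<lambda>s. X s \<omega>) \<and>
     (\<forall>j\<in>{0..<i}. ?T \<omega> < stay_time (H j) (\<lambda>s. X s \<omega>)))"
    by measurable
  then show ?thesis
    by (simp add: exit_event_def pred_def F.space_pre_sigma not_less)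
qed

lemma exit_event_meas: "exit_event t H m i \<in> sets M"
  using exit_event_pre_sigma pre_sigma_subset[OF stopping_time_stay_time] by blast

lemma disjoint_exit_events: "i < j \<Longrightarrow> exit_event t H m i \<inter> exit_event t H m j = {}"
  by (auto simp: exit_event_def) (metis atLeastLessThan_iff leD le0)

text \<open>At the exit from the intersection the path is outside some \<open>H j\<close>, whose own
  exit is then no later. The least such index is the one charged with the exit.\<close>

lemma exit_event_cases:
  assumes H: "\<And>j. j \<le> m \<Longrightarrow> open (H j)" "\<And>j. j \<le> m \<Longrightarrow> H j \<noteq> UNIV"
    and \<omega>: "\<omega> \<in> space M" "\<omega> \<notin> N0"
    and le: "stay_time (\<Inter>j\<in>{0..m}. H j) (\<lambda>s. X s \<omega>) \<le> ennreal t"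
  shows "\<exists>i\<le>m. \<omega> \<in> exit_event t H m i"
proof -
  let ?V = "\<Inter>j\<in>{0..m}. H j"
  have X: "continuous_on {0..} (\<lambda>s. X s \<omega>)" using good \<omega> by blast
  have V: "open ?V" "?V \<noteq> UNIV" using H(1) H(2)[of 0] by (auto intro!: open_INT)
  have "exit_time X ?V \<omega> < \<infinity>" using le unfolding stay_time_X[OF V \<omega>] by (rule le_less_trans) simp
  then obtain \<tau> where \<tau>: "0 \<le> \<tau>" "exit_time X ?V \<omega> = ennreal \<tau>" "X \<tau> \<omega> \<notin> ?V"
    by (rule exit_time_attained[where X = X and \<omega> = \<omega>, OF V(1) X])
  then obtain j where j: "j \<le> m" "X \<tau> \<omega> \<notin> H j" by auto
  have "stay_time (H j) (\<lambda>s. X s \<omega>) \<le> stay_time ?V (\<lambda>s. X s \<omega>)"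
    unfolding stay_time_X[OF V \<omega>] stay_time_X[OF H[OF j(1)] \<omega>] \<tau>(2)
    unfolding exit_time_def using \<tau>(1) j(2) by (intro INF_lower) auto
  then have ex: "\<exists>j. stay_time (H j) (\<lambda>s. X s \<omega>) \<le> stay_time ?V (\<lambda>s. X s \<omega>)" by blast
  define i where "i = (LEAST j. stay_time (H j) (\<lambda>s. X s \<omega>) \<le> stay_time ?V (\<lambda>s. X s \<omega>))"
  have "i \<le> j" unfolding i_def by (rule Least_le) fact
  moreover have "stay_time (H i) (\<lambda>s. X s \<omega>) \<le> stay_time ?V (\<lambda>s. X s \<omega>)"
    unfolding i_def by (rule LeastI_ex[OF ex])
  moreover have "stay_time ?V (\<lambda>s. X s \<omega>) < stay_time (H l) (\<lambda>s. X s \<omega>)" if "l < i" for l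
    using not_less_Least[OF that[unfolded i_def]] by simp
  ultimately show ?thesis using \<omega> le j(1) by (intro exI[of _ i]) (auto simp: exit_event_def)
qed

text \<open>The path cannot leave \<open>H i\<close> before it leaves the intersection, so on this
  event the two exit times coincide and the exit point is outside \<open>H i\<close>.\<close>

lemma exit_event_exit:
  assumes H: "\<And>j. j \<le> m \<Longrightarrow> open (H j)" "\<And>j. j \<le> m \<Longrightarrow> H j \<noteq> UNIV" and i: "i \<le> m"
    and \<omega>: "\<omega> \<in> exit_event t H m i" "\<omega> \<notin> N0" and t: "0 \<le> t"
  defines "\<tau> \<equiv> enn2real (stay_time (\<Inter>j\<in>{0..m}. H j) (\<lambda>s. X s \<omega>))"
  shows "0 \<le> \<tau>" "\<tau> \<le> t" "X \<tau> \<omega> \<notin> H i" "\<And>s. 0 \<le> s \<Longrightarrow> s < \<tau> \<Longrightarrow> X s \<omega> \<in> (\<Inter>j\<in>{0..m}. H j)"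
proof -
  let ?V = "\<Inter>j\<in>{0..m}. H j"
  have \<omega>M: "\<omega> \<in> space M" and le: "stay_time ?V (\<lambda>s. X s \<omega>) \<le> ennreal t"
    and lei: "stay_time (H i) (\<lambda>s. X s \<omega>) \<le> stay_time ?V (\<lambda>s. X s \<omega>)"
    using \<omega>(1) by (auto simp: exit_event_def)
  have X: "continuous_on {0..} (\<lambda>s. X s \<omega>)" using good \<omega> \<omega>M by blast
  have V: "open ?V" "?V \<noteq> UNIV" using H(1) H(2)[of 0] by (auto intro!: open_INT)
  note eqs = stay_time_X[OF V \<omega>M \<omega>(2)] stay_time_X[OF H[OF i] \<omega>M \<omega>(2)]
  have fin: "exit_time X ?V \<omega> < \<infinity>" using le unfolding eqs(1) by (rule le_less_trans) simp
  from fin obtain m1 where m1: "0 \<le> m1" "exit_time X ?V \<omega> = ennreal m1" "X m1 \<omega> \<notin> ?V"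
    "\<And>s. 0 \<le> s \<Longrightarrow> s < m1 \<Longrightarrow> X s \<omega> \<in> ?V"
    by (rule exit_time_attained[where X = X and \<omega> = \<omega>, OF V(1) X]) blast
  have \<tau>: "\<tau> = m1" using m1 eqs by (simp add: \<tau>_def)
  have fini: "exit_time X (H i) \<omega> < \<infinity>" using lei fin unfolding eqs by (rule le_less_trans)
  from fini obtain m2 where m2: "0 \<le> m2" "exit_time X (H i) \<omega> = ennreal m2" "X m2 \<omega> \<notin> H i"
    by (rule exit_time_attained[where X = X and \<omega> = \<omega>, OF H(1)[OF i] X])
  have "m2 \<le> m1" using lei eqs m1 m2 by simp
  moreover have "\<not> m2 < m1" using m1(4)[of m2] m2 i by auto
  ultimately have "m2 = m1" by simp
  then show "X \<tau> \<omega> \<notin> H i" using m2 \<tau> by simp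
  show "0 \<le> \<tau>" "\<And>s. 0 \<le> s \<Longrightarrow> s < \<tau> \<Longrightarrow> X s \<omega> \<in> ?V" using \<tau> m1 by auto
  show "\<tau> \<le> t" using le eqs m1 t \<tau> by simp
qed

text \<open>Because \<open>V \<subseteq> U\<close>, the first term is the same for all
  \<open>U\<close>. In a signed sum over regions it is thus multiplied by the sum of the
  signs.\<close>

lemma prob_exit_decomposition:
  assumes H: "\<And>j. j \<le> m \<Longrightarrow> open (H j)" "\<And>j. j \<le> m \<Longrightarrow> H j \<noteq> UNIV"
    and V: "V = (\<Inter>j\<in>{0..m}. H j)" and U: "open U" "U \<noteq> UNIV" "V \<subseteq> U" and t: "0 \<le> t"
  shows "prob {\<omega>\<in>space M. \<forall>s\<in>{0..t}. Y s \<omega> \<in> U} =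
    prob_of (P x) (\<lambda>\<omega>. exit_time X V \<omega> > ennreal t) +
    (\<Sum>i\<le>m. prob ({\<omega>\<in>space M. \<forall>s\<in>{0..t}. Y s \<omega> \<in> U} \<inter> exit_event t H m i))"
proof -
  let ?F = "{\<omega>\<in>space M. \<forall>s\<in>{0..t}. Y s \<omega> \<in> U}"
  let ?T = "\<lambda>\<omega>. stay_time V (\<lambda>s. X s \<omega>)"
  let ?S = "{\<omega>\<in>space M. ennreal t < ?T \<omega>}"
  have V': "open V" "V \<noteq> UNIV" using H(1) H(2)[of 0] by (auto simp: V intro!: open_INT)
  have [measurable]: "?T \<in> borel_measurable M" by (rule stopping_time_meas[OF stopping_time_stay_time])
  have S: "?S \<in> events" by simp
  have F: "?F \<in> events" using measurable_Y_stays[OF U(1,2) t] by simp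
  have E: "?F \<inter> exit_event t H m i \<in> events" for i
    using F exit_event_meas by auto
  have surv: "ennreal t < exit_time X V \<omega> \<longleftrightarrow> ennreal t < ?T \<omega>"
    and stay: "ennreal t < ?T \<omega> \<Longrightarrow> \<omega> \<in> ?F" if \<omega>: "\<omega> \<in> space M" "\<omega> \<notin> N0" for \<omega>
  proof -
    have X: "continuous_on {0..} (\<lambda>s. X s \<omega>)" using good \<omega> by blast
    show eq: "ennreal t < exit_time X V \<omega> \<longleftrightarrow> ennreal t < ?T \<omega>"
      by (simp add: stay_time_X[OF V' \<omega>])
    assume "ennreal t < ?T \<omega>"
    then have "\<forall>s\<in>{0..t}. X s \<omega> \<in> V" using eq exit_time_greater_iff[where X = X and \<omega> = \<omega>, OF V'(1) X t] by simp
    then show "\<omega> \<in> ?F" using U(3) \<omega> by (auto simp: Y_eq)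
  qed
  have "prob ?F = prob (?S \<union> (\<Union>i\<in>{..m}. ?F \<inter> exit_event t H m i))"
  proof (rule finite_measure_eq_AE)
    show "AE \<omega> in P x. (\<omega> \<in> ?F) = (\<omega> \<in> ?S \<union> (\<Union>i\<in>{..m}. ?F \<inter> exit_event t H m i))"
    proof (rule AE_goodI)
      fix \<omega> assume \<omega>: "\<omega> \<in> space M" "\<omega> \<notin> N0"
      show "(\<omega> \<in> ?F) = (\<omega> \<in> ?S \<union> (\<Union>i\<in>{..m}. ?F \<inter> exit_event t H m i))"
      proof (cases "ennreal t < ?T \<omega>")
        case True
        then show ?thesis using stay[OF \<omega> True] \<omega>(1) by blast
      next
        case False
        then have "?T \<omega> \<le> ennreal t" by simp
        then have "\<exists>i\<le>m. \<omega> \<in> exit_event t H m i"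
          unfolding V by (intro exit_event_cases H \<omega>)
        with False show ?thesis by auto
      qed
    qed
    show "?S \<union> (\<Union>i\<in>{..m}. ?F \<inter> exit_event t H m i) \<in> events"
      by (intro sets.Un sets.finite_UN S E finite_atMost)
  qed (rule F)
  also have "\<dots> = prob ?S + prob (\<Union>i\<in>{..m}. ?F \<inter> exit_event t H m i)"
  proof (rule finite_measure_Union)
    show "?S \<in> events" by (rule S)
    show "(\<Union>i\<in>{..m}. ?F \<inter> exit_event t H m i) \<in> events"
      by (intro sets.finite_UN E finite_atMost)
    show "?S \<inter> (\<Union>i\<in>{..m}. ?F \<inter> exit_event t H m i) = {}"
      by (auto simp: exit_event_def V)
  qed
  also have "prob (\<Union>i\<in>{..m}. ?F \<inter> exit_event t H m i) = (\<Sum>i\<le>m. prob (?F \<inter> exit_event t H m i))"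
  proof (rule finite_measure_finite_Union)
    show "disjoint_family_on (\<lambda>i. ?F \<inter> exit_event t H m i) {..m}"
      unfolding disjoint_family_on_def
    proof (intro ballI impI)
      fix i j :: nat assume "i \<noteq> j"
      then have "exit_event t H m i \<inter> exit_event t H m j = {}"
        using disjoint_exit_events[of i j] disjoint_exit_events[of j i] by (cases i j rule: linorder_cases) auto
      then show "?F \<inter> exit_event t H m i \<inter> (?F \<inter> exit_event t H m j) = {}" by blast
    qed
  qed (use E in auto)
  also have "prob ?S = prob_of (P x) (\<lambda>\<omega>. exit_time X V \<omega> > ennreal t)"
  proof -
    have "prob_of (P x) (\<lambda>\<omega>. exit_time X V \<omega> > ennreal t) = prob {\<omega>\<in>space (P x). ennreal t < ?T \<omega>}"
      by (rule prob_of_eq_AE) (use S surv in \<open>auto intro: AE_goodI\<close>)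
    then show ?thesis by simp
  qed
  finally show ?thesis .
qed

end

section \<open>Cancellation at each wall and the Pfaffian formula\<close>

lemma wall_events_cancel:
  fixes x :: "real ^ 'k::{finite,linorder}"
  assumes R: "reflectable_start affine_weyl_D M P X x N0" and t: "0 \<le> t"
    and k: "3 \<le> CARD('k)" and n: "CARD('k) \<le> n" "n \<le> Suc CARD('k)" and x: "x \<in> alcove_D"
    and i: "i \<le> CARD('k)"
  shows "(\<Sum>\<pi>\<in>pair_partitions {1..n}. (- 1) ^ crossings \<pi> *
    measure (P x) ({\<omega>\<in>space M. \<forall>s\<in>{0..t}. reflectable_start.Y X x N0 s \<omega> \<in> region \<pi>} \<inter>
      reflectable_start.exit_event M X t (\<lambda>i. {v. 0 < wall_form i v}) CARD('k) i)) = 0"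
proof -
  interpret reflectable_start affine_weyl_D M P X x N0 by (rule R)
  let ?H = "\<lambda>i. {v :: (real, 'k) vec. 0 < wall_form i v}"
  let ?A = "exit_event t ?H CARD('k) i" and ?s = "wall_reflection i :: (real, 'k) vec \<Rightarrow> (real, 'k) vec"
  let ?F = "\<lambda>\<pi>. {\<omega>\<in>space M. \<forall>s\<in>{0..t}. Y s \<omega> \<in> region \<pi>}"
  let ?V = "\<Inter>j\<in>{0..CARD('k)}. ?H j"
  let ?T = "\<lambda>\<omega>. stay_time ?V (\<lambda>s. X s \<omega>)"
  define a where "a = wall_index CARD('k) i"
  have V: "alcove_D = ?V" using alcove_D_eq_walls[OF k] by auto
  have H: "open (?H j)" "?H j \<noteq> UNIV" if "j \<le> CARD('k)" for j
    using that open_wall[of j] wall_halfspace_neq_UNIV[OF k that] by auto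
  have exit: "0 \<le> enn2real (?T \<omega>)" "enn2real (?T \<omega>) \<le> t" "wall_form i (X (enn2real (?T \<omega>)) \<omega>) = 0"
    "\<And>s. 0 \<le> s \<Longrightarrow> s < enn2real (?T \<omega>) \<Longrightarrow> X s \<omega> \<in> alcove_D"
    if \<omega>: "\<omega> \<in> ?A" "\<omega> \<notin> N0" for \<omega>
  proof -
    let ?\<tau> = "enn2real (?T \<omega>)"
    have \<omega>M: "\<omega> \<in> space M" using \<omega> by (simp add: exit_event_def)
    note * = exit_event_exit[OF H i \<omega> t]
    show \<tau>: "0 \<le> ?\<tau>" "?\<tau> \<le> t" "\<And>s. 0 \<le> s \<Longrightarrow> s < ?\<tau> \<Longrightarrow> X s \<omega> \<in> alcove_D"
      using * unfolding V by auto
    have "X 0 \<omega> = x" and cont: "continuous_on {0..} (\<lambda>s. X s \<omega>)" using good[OF \<omega>M \<omega>(2)] by auto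
    moreover have "x \<in> ?H i" using x i unfolding V by auto
    \<comment> \<open>The start is strictly inside, so the exit time is a limit of earlier times.
      Hence the form is nonnegative at the exit by continuity, and not positive because
      \<open>H i\<close> has been left; so it is zero.\<close>
    ultimately have "?\<tau> \<noteq> 0" using *(3) by auto
    then have cl: "closure {0..<?\<tau>} = {0..?\<tau>}" using \<tau>(1) by (intro closure_atLeastLessThan) linarith
    have cont_wall: "continuous_on {0..?\<tau>} (\<lambda>s. wall_form i (X s \<omega>))"
      by (rule continuous_on_compose2[OF continuous_wall_form continuous_on_subset[OF cont]]) auto
    have "0 \<le> wall_form i (X s \<omega>)" if "s \<in> {0..<?\<tau>}" for s
      using \<tau>(3)[of s] that i unfolding V by (auto intro: less_imp_le)
    then have "0 \<le> wall_form i (X ?\<tau> \<omega>)"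
      using continuous_ge_on_closure[of "{0..<?\<tau>}" "\<lambda>s. wall_form i (X s \<omega>)" ?\<tau> 0] cont_wall \<tau>(1) cl by simp
    then show "wall_form i (X ?\<tau> \<omega>) = 0" using *(3) by auto
  qed
  show ?thesis
  proof (rule sum_sign_swap_cancel[where i = a])
    show "a \<in> {1..n}" "Suc a \<in> {1..n}" using k i n by (auto simp: a_def wall_index_def)
    fix \<pi> assume \<pi>: "\<pi> \<in> pair_partitions {1..n}"
    have fin: "finite \<pi>" using \<pi> by (auto simp: pair_partitions_iff intro: finite_elements[rotated])
    have sub: "(alcove_D :: (real, 'k) vec set) \<subseteq> region \<rho>" if "\<rho> \<in> pair_partitions {1..n}" for \<rho>
      unfolding region_def
    proof (rule INT_greatest)
      fix B assume "B \<in> \<rho>"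
      then show "(alcove_D :: (real, 'k) vec set) \<subseteq> block_region B"
        using that by (intro alcove_D_subset_block_region[OF _ _ k, of _ n]) (auto simp: pair_partitions_iff partition_on_def)
    qed
    note U = open_region[OF fin] region_neq_UNIV[OF k \<pi> n]
    {
      assume a\<pi>: "{a, Suc a} \<in> \<pi>"
      have sub_N0: "?F \<pi> \<inter> ?A \<subseteq> N0"
      proof (rule subsetI, rule ccontr)
        fix \<omega> assume \<omega>: "\<omega> \<in> ?F \<pi> \<inter> ?A" "\<omega> \<notin> N0"
        then have A: "\<omega> \<in> ?A" by blast
        have "X (enn2real (?T \<omega>)) \<omega> \<in> region \<pi>"
          using \<omega> exit(1,2)[OF A \<omega>(2)] by (auto simp: Y_eq)
        moreover have "X (enn2real (?T \<omega>)) \<omega> \<notin> region \<pi>"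
          by (rule wall_disjoint_region[OF k i a_def a\<pi> exit(3)[OF A \<omega>(2)]])
        ultimately show False by blast
      qed
      have "?F \<pi> \<inter> ?A \<in> events"
        using measurable_Y_stays[OF U t] exit_event_meas by auto
      from null_sets_subset[OF N0 this sub_N0] have "?F \<pi> \<inter> ?A \<in> null_sets (P x)" .
      then show "prob (?F \<pi> \<inter> ?A) = 0" by (rule measure_eq_0_null_sets)
    }
    {
      assume a\<pi>: "{a, Suc a} \<notin> \<pi>"
      \<comment> \<open>Until the exit the path is in the alcove, which lies in every region, so
        only the part after the exit is tested. On \<open>N0\<close> the path is constantly
        \<open>x\<close> and both conditions hold.\<close>
      have before: "?F \<rho> \<inter> ?A = {\<omega>\<in>?A. \<forall>r\<in>{enn2real (?T \<omega>)..t}. Y r \<omega> \<in> region \<rho>}"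
        if \<rho>: "\<rho> \<in> pair_partitions {1..n}" for \<rho>
      proof -
        have "(\<forall>s\<in>{0..t}. Y s \<omega> \<in> region \<rho>) \<longleftrightarrow> (\<forall>r\<in>{enn2real (?T \<omega>)..t}. Y r \<omega> \<in> region \<rho>)" if A: "\<omega> \<in> ?A" for \<omega>
        proof (cases "\<omega> \<in> N0")
          case True
          then show ?thesis using sub[OF \<rho>] x by (auto simp: Y_def)
        next
          case False
          have Y_before: "Y s \<omega> \<in> region \<rho>" if "0 \<le> s" "s < enn2real (?T \<omega>)" for s
            using exit(4)[OF A False that] sub[OF \<rho>] by (auto simp: Y_eq[OF False])
          show ?thesis
          proof
            assume after: "\<forall>r\<in>{enn2real (?T \<omega>)..t}. Y r \<omega> \<in> region \<rho>"
            show "\<forall>s\<in>{0..t}. Y s \<omega> \<in> region \<rho>"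
            proof
              fix s assume "s \<in> {0..t}"
              then show "Y s \<omega> \<in> region \<rho>"
                using Y_before[of s] after by (cases "s < enn2real (?T \<omega>)") simp_all
            qed
          next
            assume all: "\<forall>s\<in>{0..t}. Y s \<omega> \<in> region \<rho>"
            show "\<forall>r\<in>{enn2real (?T \<omega>)..t}. Y r \<omega> \<in> region \<rho>"
            proof
              fix r assume "r \<in> {enn2real (?T \<omega>)..t}"
              then have "r \<in> {0..t}" using order_trans[OF exit(1)[OF A False], of r] by simp
              with all show "Y r \<omega> \<in> region \<rho>" by blast
            qed
          qed
        qed
        then show ?thesis by (auto simp: exit_event_def)
      qed
      have swap: "swap_partition a \<pi> \<in> pair_partitions {1..n}"
        using \<pi> k i n by (intro swap_partition_pair_partitions) (auto simp: a_def wall_index_def)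
      have "prob (?F (swap_partition a \<pi>) \<inter> ?A) = prob {\<omega>\<in>?A. \<forall>r\<in>{enn2real (?T \<omega>)..t}. ?s (Y r \<omega>) \<in> region \<pi>}"
        unfolding before[OF swap] unfolding region_swap_partition[OF k i a_def \<pi> n(2) a\<pi>] ..
      also have "\<dots> = prob {\<omega>\<in>?A. \<forall>r\<in>{enn2real (?T \<omega>)..t}. Y r \<omega> \<in> region \<pi>}"
      proof (rule reflection_principle[OF stopping_time_stay_time exit_event_pre_sigma _ t _ _ _ U])
        show "?T \<omega> \<le> ennreal t" if "\<omega> \<in> ?A" for \<omega> using that by (simp add: exit_event_def)
        show "?s \<in> affine_weyl_D" by (rule wall_reflection_in_affine_weyl_D[OF k i])
        show "continuous_on UNIV ?s" unfolding wall_reflection_def by (rule continuous_affine_reflection)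
        show "?s (X (enn2real (?T \<omega>)) \<omega>) = X (enn2real (?T \<omega>)) \<omega>" if "\<omega> \<in> ?A" "\<omega> \<notin> N0" for \<omega>
          by (rule wall_reflection_fixed[OF exit(3)[OF that]])
      qed
      also have "\<dots> = prob (?F \<pi> \<inter> ?A)" unfolding before[OF \<pi>] ..
      finally show "prob (?F (swap_partition a \<pi>) \<inter> ?A) = prob (?F \<pi> \<inter> ?A)" .
    }
  qed simp
qed

text \<open>The parameter \<open>n\<close> is the even one among \<open>k\<close> and
  \<open>k + 1\<close>, which treats both parities at once. In the signed sum of decompositions, the
  survival term has total coefficient 1 and each wall contributes 0.\<close>

lemma exit_probability_pfaffian:
  fixes x :: "real ^ 'k::{finite,linorder}"
  assumes k: "3 \<le> CARD('k)" and reflectable_X: "reflectable affine_weyl_D M P X"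
    and indep: "indep_orthogonal_components P X" and x: "x \<in> alcove_D" and t: "0 \<le> t"
    and n: "CARD('k) \<le> n" "n \<le> Suc CARD('k)" "even n"
  shows "prob_of (P x) (\<lambda>\<omega>. exit_time X alcove_D \<omega> > ennreal t) =
    pfaffian {1..n} (\<lambda>i j. if j \<le> CARD('k) then p_breve (P x) X t i j else 1)"
proof -
  have sp: "space (P x) = space M" using reflectable_X sets_eq_imp_space_eq[of "P x" M] by (auto simp: reflectable_def)
  have "AE \<omega> in P x. X 0 \<omega> = x \<and> continuous_on {0..} (\<lambda>t. X t \<omega>)"
    using reflectable_X by (auto simp: reflectable_def)
  then obtain N0 where N0: "N0 \<in> null_sets (P x)"
    "\<And>\<omega>. \<omega> \<in> space M \<Longrightarrow> \<omega> \<notin> N0 \<Longrightarrow> X 0 \<omega> = x \<and> continuous_on {0..} (\<lambda>t. X t \<omega>)"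
    unfolding sp[symmetric] by (auto elim!: AE_E3)
  have R: "reflectable_start affine_weyl_D M P X x N0"
    by unfold_locales (use reflectable_X N0 in auto)
  interpret reflectable_start affine_weyl_D M P X x N0 by (rule R)
  let ?H = "\<lambda>i. {v :: (real, 'k) vec. 0 < wall_form i v}"
  let ?F = "\<lambda>\<pi>. {\<omega>\<in>space M. \<forall>s\<in>{0..t}. Y s \<omega> \<in> region \<pi>}"
  let ?A = "exit_event t ?H CARD('k)"
  let ?S = "prob_of (P x) (\<lambda>\<omega>. exit_time X alcove_D \<omega> > ennreal t)"
  have V: "alcove_D = (\<Inter>j\<in>{0..CARD('k)}. ?H j)" using alcove_D_eq_walls[OF k] by auto
  have region: "prob (?F \<pi>) = (\<Prod>B\<in>\<pi>. if Max B \<le> CARD('k) then p_breve (P x) X t (Min B) (Max B) else 1)"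
    and decomp: "prob (?F \<pi>) = ?S + (\<Sum>i\<le>CARD('k). prob (?F \<pi> \<inter> ?A i))"
    if \<pi>: "\<pi> \<in> pair_partitions {1..n}" for \<pi>
  proof -
    have fin: "finite \<pi>" using \<pi> by (auto simp: pair_partitions_iff intro: finite_elements[rotated])
    note U = open_region[OF fin] region_neq_UNIV[OF k \<pi> n(1,2)]
    show "prob (?F \<pi>) = (\<Prod>B\<in>\<pi>. if Max B \<le> CARD('k) then p_breve (P x) X t (Min B) (Max B) else 1)"
      using prob_of_region[OF R indep t k \<pi> n(1,2)] prob_of_stays[OF U t] by simp
    have "alcove_D \<subseteq> (region \<pi> :: (real, 'k) vec set)"
      unfolding region_def
    proof (rule INT_greatest)
      fix B assume "B \<in> \<pi>"
      then show "alcove_D \<subseteq> (block_region B :: (real, 'k) vec set)"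
        using \<pi> by (intro alcove_D_subset_block_region[OF _ _ k, of _ n]) (auto simp: pair_partitions_iff partition_on_def)
    qed
    then show "prob (?F \<pi>) = ?S + (\<Sum>i\<le>CARD('k). prob (?F \<pi> \<inter> ?A i))"
      by (intro prob_exit_decomposition[OF _ _ V U _ t]) (auto simp: open_wall wall_halfspace_neq_UNIV[OF k])
  qed
  obtain m where m: "n = 2 * m" using n(3) by (rule evenE)
  let ?e = "\<lambda>\<pi>. (- 1 :: real) ^ crossings (\<pi> :: nat set set)"
  have "pfaffian {1..n} (\<lambda>i j. if j \<le> CARD('k) then p_breve (P x) X t i j else 1) =
      (\<Sum>\<pi>\<in>pair_partitions {1..n}. ?e \<pi> * (?S + (\<Sum>i\<le>CARD('k). prob (?F \<pi> \<inter> ?A i))))"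
    unfolding pfaffian_def using region decomp by (intro sum.cong) auto
  also have "\<dots> = (\<Sum>\<pi>\<in>pair_partitions {1..n}. ?e \<pi>) * ?S +
      (\<Sum>\<pi>\<in>pair_partitions {1..n}. \<Sum>i\<le>CARD('k). ?e \<pi> * prob (?F \<pi> \<inter> ?A i))"
    by (simp only: distrib_left sum.distrib sum_distrib_left sum_distrib_right)
  also have "(\<Sum>\<pi>\<in>pair_partitions {1..n}. \<Sum>i\<le>CARD('k). ?e \<pi> * prob (?F \<pi> \<inter> ?A i)) =
      (\<Sum>i\<le>CARD('k). \<Sum>\<pi>\<in>pair_partitions {1..n}. ?e \<pi> * prob (?F \<pi> \<inter> ?A i))"
    by (rule sum.swap)
  also have "\<dots> = 0"
    using wall_events_cancel[OF R t k n(1,2) x] by (intro sum.neutral) auto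
  also have "(\<Sum>\<pi>\<in>pair_partitions {1..n}. ?e \<pi>) = 1"
    unfolding m by (rule sum_sign_pair_partitions)
  finally show ?thesis by simp
qed

theorem mainTheorem12:
  fixes M :: "'w measure"
    and P :: "real ^ 'k::{finite,linorder} \<Rightarrow> 'w measure"
    and X :: "real \<Rightarrow> 'w \<Rightarrow> real ^ 'k::{finite,linorder}"
    and x :: "real ^ 'k::{finite,linorder}"
    and t :: real
  assumes "CARD('k) \<ge> 3"
    and "reflectable affine_weyl_D M P X"
    and "indep_orthogonal_components P X"
    and "x \<in> alcove_D"
    and "t \<ge> 0"
  shows "prob_of (P x) (\<lambda>\<omega>. exit_time X alcove_D \<omega> > ennreal t) =
    (if even CARD('k) then pfaffian {1..CARD('k)} (p_breve (P x) X t)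
     else (\<Sum>l = 1..CARD('k). (- 1) ^ (l - 1) * pfaffian ({1..CARD('k)} - {l}) (p_breve (P x) X t)))"
proof (cases "even CARD('k)")
  case True
  \<comment> \<open>For \<open>n = k\<close> no block reaches beyond \<open>k\<close>, so the
    default entry 1 never occurs.\<close>
  have "Max B \<le> CARD('k)" if "\<pi> \<in> pair_partitions {1..CARD('k)}" "B \<in> \<pi>" for \<pi> B
  proof -
    have "B \<subseteq> {1..CARD('k)}" "card B = 2" using that by (auto simp: pair_partitions_iff partition_on_def)
    then show ?thesis using Max_in[of B] by (auto simp: card_2_iff)
  qed
  then have "pfaffian {1..CARD('k)} (\<lambda>i j. if j \<le> CARD('k) then p_breve (P x) X t i j else 1) =
      pfaffian {1..CARD('k)} (p_breve (P x) X t)"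
    unfolding pfaffian_def by (intro sum.cong prod.cong arg_cong2[where f = "(*)"] refl) simp
  with True show ?thesis
    using exit_probability_pfaffian[OF assms, of "CARD('k)"] by simp
next
  case False
  then show ?thesis
    using exit_probability_pfaffian[OF assms, of "Suc CARD('k)"] sum_pfaffian_delete[where k = "CARD('k)"] by simp
qed

end
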